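(* Let $k$ be a field and $n\ge4$. The $n\times n$ matrix with $(i,j)$ entry $\dim_k e_i\Pi(C_n)e_j$ is $$\left(\begin{array}{ccccc}2&2&2&\cdots&2\\2&4&4&\cdots&4\\2&4&6&\cdots&6\\\vdots&\vdots&\vdots&\ddots&\vdots\\2&4&6&\cdots&2n\end{array}\right),$$ that is, the $(i,j)$ entry is $2\min\{i,j\}$. The bigraded Hilbert--Poincaré series (with $t$ recording path length and $s$ recording $x$-degree) is $$h_{e_i\Pi(C_n)e_j}(s,t)=t^{d(i,j)}\big(1+t^2+t^4+\cdots+t^{2\min\{i,j\}-2}\big)\big(1+s\,t^{2d(\max\{i,j\},n)}\big),$$ where $d(a,b)=|a-b|$.
   Context: Definition of $\Pi(C_n)$. It is the decorated preprojective algebra of the linear quiver with vertices $1,\dots,n$, decorated by $k$ at vertices $1,\dots,n-1$, by $S=k[x]/(x^2)$ at vertex $n$, by ${}_kk_k$ on the arrows $j\to j+1$ for $j\le n-2$, and by ${}_kS_S$ on the arrow $n-1\to n$ (signs in the relations may be dropped since the quiver is bipartite). Explicitly, $\Pi(C_n)$ is the $k$-algebra generated by orthogonal idempotents $e_1,\dots,e_n$ summing to $1$, arrows $\gamma_{i,i+1}\in e_i(\cdot)e_{i+1}$, $\gamma_{i+1,i}\in e_{i+1}(\cdot)e_i$ for $1\le i\le n-1$, and an element $x=x_n\in e_n(\cdot)e_n$ (products of paths read left to right), with relations - $x^2=0$; - $\gamma_{1,2}\gamma_{2,1}=0$; - $\gamma_{j,j+1}\gamma_{j+1,j}+\gamma_{j,j-1}\gamma_{j-1,j}=0$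 for $2\le j\le n-1$; - $\gamma_{n,n-1}\gamma_{n-1,n}x+x\gamma_{n,n-1}\gamma_{n-1,n}=0$. Gradings. Path length: arrows have length $1$, $e_i$ and $x$ have length $0$. $x$-degree: $x$ has degree $1$, the $e_i$ and the arrows degree $0$. The bigraded Hilbert--Poincaré series is $\sum_{a,b}\dim_k(\text{length }a,\ x\text{-degree }b)\,t^as^b$. *)

theory Defs
  imports
    "HOL-Library.Poly_Mapping"
    "HOL-Algebra.Embedded_Algebras"
    "HOL-Algebra.QuotRing"
    "HOL-Computational_Algebra.Formal_Power_Series"
begin

section \<open>Free associative algebras\<close>

text \<open>
  The free monoid on \<open>'g\<close>, written additively because the convolution product of
  \<open>Poly_Mapping\<close> is built from the addition of the index type.  Thus
  \<open>'g word \<Rightarrow>\<^sub>0 'k\<close> is the monoid algebra of the free monoid, i.e. the free associative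
  unital \<open>'k\<close>-algebra on \<open>'g\<close>.
\<close>

datatype 'g word = Word (letters: "'g list")

instantiation word :: (type) monoid_add
begin

definition zero_word :: "'g word" where
  "zero_word = Word []"

definition plus_word :: "'g word \<Rightarrow> 'g word \<Rightarrow> 'g word" where
  "plus_word u v = Word (letters u @ letters v)"

instance
  by standard (simp_all add: zero_word_def plus_word_def)

end

definition free_algebra :: "'g set \<Rightarrow> ('g word \<Rightarrow>\<^sub>0 'k::field) ring" where
  "free_algebra G =
    \<lparr>carrier = {f. \<forall>w \<in> Poly_Mapping.keys f. set (letters w) \<subseteq> G},
     monoid.mult = (*), one = 1, zero = 0, add = (+)\<rparr>"

definition gen_word :: "'g list \<Rightarrow> 'g word \<Rightarrow>\<^sub>0 'k::field" where
  "gen_word gs = Poly_Mapping.single (Word gs) 1"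

lemma free_algebra_simps [simp]:
  "monoid.mult (free_algebra G) = (*)" "one (free_algebra G) = 1"
  "zero (free_algebra G) = 0" "add (free_algebra G) = (+)"
  by (simp_all add: free_algebra_def)

lemma ring_free_algebra: "ring (free_algebra G :: ('g word \<Rightarrow>\<^sub>0 'k::field) ring)"
proof (rule ringI)
  have "\<exists>y \<in> carrier (free_algebra G). y + x = 0"
    if "x \<in> carrier (free_algebra G)" for x :: "'g word \<Rightarrow>\<^sub>0 'k"
    by (rule bexI [of _ "- x"]) (use that in \<open>auto simp: free_algebra_def\<close>)
  then show "abelian_group (free_algebra G :: ('g word \<Rightarrow>\<^sub>0 'k) ring)"
    by (intro abelian_groupI)
       (auto simp: free_algebra_def add_ac dest!: subsetD [OF Poly_Mapping.keys_add])
  show "monoid (free_algebra G :: ('g word \<Rightarrow>\<^sub>0 'k) ring)"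
  proof (rule monoidI, goal_cases)
    case (1 x y)
    then show ?case
      using keys_mult [of x y] by (fastforce simp: free_algebra_def plus_word_def)
  qed (auto simp: free_algebra_def mult.assoc zero_word_def)
qed (simp_all add: distrib_left distrib_right)

section \<open>The algebra \<open>\<Pi>(C\<^sub>n)\<close>\<close>

text \<open>
  \<open>Vertex i\<close> is \<open>e\<^sub>i\<close>, \<open>Arrow i j\<close> is \<open>\<gamma>\<^sub>i\<^sub>j\<close> and \<open>Loop\<close> is \<open>x\<close>.  The type contains
  generators for all vertices; \<open>gens n\<close> selects those of the quiver with vertices
  \<open>1, \<dots>, n\<close>.
\<close>

datatype gen = Vertex nat | Arrow nat nat | Loop

definition arrows :: "nat \<Rightarrow> (nat \<times> nat) set" where
  "arrows n = {(i, j). i \<in> {1..n} \<and> j \<in> {1..n} \<and> (j = i + 1 \<or> i = j + 1)}"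

definition gens :: "nat \<Rightarrow> gen set" where
  "gens n = Vertex ` {1..n} \<union> (\<lambda>(i, j). Arrow i j) ` arrows n \<union> {Loop}"

text \<open>
  An element \<open>r\<close> of this set encodes the relation \<open>r = 0\<close>.  The first five sets say that
  the \<open>e\<^sub>i\<close> are orthogonal idempotents with sum \<open>1\<close>, that \<open>\<gamma>\<^sub>i\<^sub>j\<close> lies in
  \<open>e\<^sub>i(\<cdot>)e\<^sub>j\<close>, and that \<open>x\<close> lies in \<open>e\<^sub>n(\<cdot>)e\<^sub>n\<close>.  Paths are read left to right.
\<close>

definition relations :: "nat \<Rightarrow> (gen word \<Rightarrow>\<^sub>0 'k::field) set" where
  "relations n =
     {gen_word [Vertex i, Vertex i] - gen_word [Vertex i] | i. i \<in> {1..n}}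
   \<union> {gen_word [Vertex i, Vertex j] | i j. i \<in> {1..n} \<and> j \<in> {1..n} \<and> i \<noteq> j}
   \<union> {(\<Sum>i\<in>{1..n}. gen_word [Vertex i]) - 1}
   \<union> {gen_word [Vertex i, Arrow i j, Vertex j] - gen_word [Arrow i j] | i j. (i, j) \<in> arrows n}
   \<union> {gen_word [Vertex n, Loop, Vertex n] - gen_word [Loop]}
   \<union> {gen_word [Loop, Loop]}
   \<union> {gen_word [Arrow 1 2, Arrow 2 1]}
   \<union> {gen_word [Arrow j (j + 1), Arrow (j + 1) j] + gen_word [Arrow j (j - 1), Arrow (j - 1) j]
        | j. 2 \<le> j \<and> j \<le> n - 1}
   \<union> {gen_word [Arrow n (n - 1), Arrow (n - 1) n, Loop]
        + gen_word [Loop, Arrow n (n - 1), Arrow (n - 1) n]}"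

text \<open>The \<open>itself\<close> argument \<open>K\<close> fixes the ground field.\<close>

definition rel_ideal :: "'k::field itself \<Rightarrow> nat \<Rightarrow> (gen word \<Rightarrow>\<^sub>0 'k) set" where
  "rel_ideal K n = genideal (free_algebra (gens n)) (relations n)"

definition Pi_C :: "'k::field itself \<Rightarrow> nat \<Rightarrow> (gen word \<Rightarrow>\<^sub>0 'k) set ring" where
  "Pi_C K n = free_algebra (gens n) Quot rel_ideal K n"

definition cls :: "nat \<Rightarrow> (gen word \<Rightarrow>\<^sub>0 'k::field) \<Rightarrow> (gen word \<Rightarrow>\<^sub>0 'k) set" where
  "cls n f = rel_ideal TYPE('k) n +>\<^bsub>free_algebra (gens n)\<^esub> f"

text \<open>
  The image of the ground field under its structure map \<open>c \<mapsto> c \<cdot> 1\<close>; this is the form in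
  which \<open>ring.dimension\<close> expects the field of scalars.  The structure map is injective
  because \<open>\<Pi>(C\<^sub>n)\<close> is nonzero, so dimensions over the image are dimensions over \<open>'k\<close>.
\<close>

definition scalars :: "'k::field itself \<Rightarrow> nat \<Rightarrow> (gen word \<Rightarrow>\<^sub>0 'k) set set" where
  "scalars K n = range (\<lambda>c :: 'k. cls n (Poly_Mapping.single 0 c))"

lemma relations_closed:
  assumes "n \<ge> 2"
  shows "(relations n :: (gen word \<Rightarrow>\<^sub>0 'k::field) set) \<subseteq> carrier (free_algebra (gens n))"
proof -
  let ?C = "carrier (free_algebra (gens n)) :: (gen word \<Rightarrow>\<^sub>0 'k) set"
  have gen_word: "gen_word gs \<in> ?C" if "set gs \<subseteq> gens n" for gs
    using that by (auto simp: gen_word_def free_algebra_def)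
  have add: "f + g \<in> ?C" if "f \<in> ?C" "g \<in> ?C" for f g
    using that Poly_Mapping.keys_add [of f g] by (auto simp: free_algebra_def)
  have diff: "f - g \<in> ?C" if "f \<in> ?C" "g \<in> ?C" for f g
    using that keys_diff [of f g] by (auto simp: free_algebra_def)
  have one: "1 \<in> ?C"
    by (auto simp: free_algebra_def zero_word_def)
  have sum: "(\<Sum>i\<in>A. gen_word [Vertex i]) \<in> ?C" if "A \<subseteq> {1..n}" for A
  proof -
    have "finite A"
      using that finite_subset by blast
    then show ?thesis
      using that
    proof induction
      case (insert i A)
      then show ?case
        by (simp, intro add gen_word) (auto simp: gens_def)
    qed (simp add: free_algebra_def)
  qed
  have V: "Vertex i \<in> gens n" if "i \<in> {1..n}" for i
    using that by (simp add: gens_def)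
  have A: "Arrow i j \<in> gens n" if "(i, j) \<in> arrows n" for i j
    using that by (force simp: gens_def)
  have L: "Loop \<in> gens n"
    by (simp add: gens_def)
  have arr: "i \<in> {1..n}" "j \<in> {1..n}" if "(i, j) \<in> arrows n" for i j
    using that by (auto simp: arrows_def)
  have ends: "n \<in> {1..n}" "(1, 2) \<in> arrows n" "(2, 1) \<in> arrows n"
    "(n, n - 1) \<in> arrows n" "(n - 1, n) \<in> arrows n"
    using assms by (auto simp: arrows_def)
  have mid: "(j, j + 1) \<in> arrows n" "(j + 1, j) \<in> arrows n"
    "(j, j - 1) \<in> arrows n" "(j - 1, j) \<in> arrows n" if "2 \<le> j" "j \<le> n - 1" for j
    using that by (auto simp: arrows_def)
  show ?thesis
    unfolding relations_def Un_subset_iff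
    using ends mid
    by (intro conjI)
       (auto intro!: add diff one sum gen_word V A L intro: arr
         simp del: One_nat_def atLeastAtMost_iff add_Suc_right)
qed

lemma ring_Pi_C:
  assumes "n \<ge> 2"
  shows "ring (Pi_C K n)"
  unfolding Pi_C_def rel_ideal_def
  by (intro ideal.quotient_is_ring ring.genideal_ideal ring_free_algebra
        relations_closed assms)

definition corner :: "'k::field itself \<Rightarrow> nat \<Rightarrow> nat \<Rightarrow> nat \<Rightarrow> (gen word \<Rightarrow>\<^sub>0 'k) set set" where
  "corner K n i j =
    {cls n (gen_word [Vertex i]) \<otimes>\<^bsub>Pi_C K n\<^esub> y \<otimes>\<^bsub>Pi_C K n\<^esub> cls n (gen_word [Vertex j]) | y. y \<in> carrier (Pi_C K n)}"

section \<open>Gradings and Hilbert--Poincare series\<close>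

definition path_length :: "gen word \<Rightarrow> nat" where
  "path_length w = length (filter (\<lambda>g. \<exists>i j. g = Arrow i j) (letters w))"

definition x_degree :: "gen word \<Rightarrow> nat" where
  "x_degree w = length (filter (\<lambda>g. g = Loop) (letters w))"

text \<open>
  All relations are homogeneous for both degrees, so the grading of the free algebra descends
  to the quotient and its components are the images of those of the free algebra.
\<close>

definition graded_part :: "'k::field itself \<Rightarrow> nat \<Rightarrow> nat \<Rightarrow> nat \<Rightarrow> (gen word \<Rightarrow>\<^sub>0 'k) set set" where
  "graded_part K n a b =
    cls n ` {f \<in> carrier (free_algebra (gens n)).
              \<forall>w \<in> Poly_Mapping.keys f. path_length w = a \<and> x_degree w = b}"

text \<open>
  Bivariate power series are represented as power series in \<open>s\<close> (the outer variable)
  whose coefficients are power series in \<open>t\<close>.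
\<close>

definition hilbert_series :: "'k::field itself \<Rightarrow> nat \<Rightarrow> nat \<Rightarrow> nat \<Rightarrow> nat fps fps" where
  "hilbert_series K n i j =
    Abs_fps (\<lambda>b. Abs_fps (\<lambda>a.
      ring.dim (Pi_C K n) (scalars K n) (corner K n i j \<inter> graded_part K n a b)))"

definition s_var :: "nat fps fps" where
  "s_var = fps_X"

definition t_var :: "nat fps fps" where
  "t_var = fps_const fps_X"

definition vdist :: "nat \<Rightarrow> nat \<Rightarrow> nat" where
  "vdist a b = nat \<bar>int a - int b\<bar>"

end

theory Submission
  imports Defs
begin

text \<open>
  Change the sign of every other upward arrow and put
  \<open>z = \<Sum>\<^sub>j \<gamma>\<^sub>j\<^sub>,\<^sub>j\<^sub>-\<^sub>1 \<gamma>\<^sub>j\<^sub>-\<^sub>1\<^sub>,\<^sub>j\<close>.  Then \<open>z\<close> commutes with the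
  arrows and anticommutes with \<open>x\<close>, and \<open>e\<^sub>j z\<^sup>j = 0\<close> because \<open>e\<^sub>1 z = 0\<close>.  Hence every path from \<open>i\<close> to \<open>j\<close> is, up to sign, zero or one of
  \<open>p\<^sub>i\<^sub>j z\<^sup>m\<close> and \<open>p\<^sub>i\<^sub>n x p\<^sub>n\<^sub>j z\<^sup>m\<close> with \<open>m < min i j\<close>, where \<open>p\<close> denotes straight paths.
  These are linearly independent because the multiplication rules they satisfy define a
  module over the free algebra on which all relations act as zero.
\<close>

text \<open>The table \<open>step\<close> is used twice. With values in the field it lets the free
  algebra act on functions on the states, the relations act as zero, and coefficient functionals
  prove independence. With the values \<open>nf n\<close> in the free algebra itself, the same
  recursion computes paths modulo the relations, which proves spanning. The bound
  \<open>m < min i j\<close> uses both ends of a path: turns can be moved to its start as well as to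
  its end, so the nilpotency at either vertex limits their number. Normal forms carry signs, whereas
  degrees are read off from words. The bases therefore consist of classes of single words, each of
  which leads through the table to its state with coefficient 1 or -1; the table also carries the
  bidegree along.\<close>

lemma poly_mapping_additive_induct [case_names zero single add]:
  fixes f :: "'a \<Rightarrow>\<^sub>0 'b::comm_monoid_add"
  assumes zero: "P 0"
    and single: "\<And>w c. P (Poly_Mapping.single w c)"
    and add: "\<And>f g. P f \<Longrightarrow> P g \<Longrightarrow> P (f + g)"
  shows "P f"
proof -
  have "P (\<Sum>w\<in>A. Poly_Mapping.single w (Poly_Mapping.lookup f w))" if "finite A" for A
    using that by (induction A) (auto intro: assms)
  moreover have "f = (\<Sum>w\<in>Poly_Mapping.keys f. Poly_Mapping.single w (Poly_Mapping.lookup f w))"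
    by (rule poly_mapping_eqI) (simp add: lookup_sum lookup_single when_def in_keys_iff)
  ultimately show ?thesis
    by (metis finite_keys)
qed

section \<open>A right module with a monomial basis\<close>

type_synonym state = "nat \<times> nat \<times> nat \<times> bool"

fun valid :: "nat \<Rightarrow> state \<Rightarrow> bool" where
  "valid n (i, j, m, b) \<longleftrightarrow> i \<in> {1..n} \<and> j \<in> {1..n} \<and> m < min i j"

text \<open>
  The state \<open>(i, j, m, b)\<close> stands for the basis vector of \<open>e\<^sub>i \<Pi> e\<^sub>j\<close> given by the straight path
  from \<open>i\<close> to \<open>j\<close> (if \<open>b\<close>: the straight path to \<open>n\<close>, then \<open>x\<close>, then the straight path to
  \<open>j\<close>) followed by \<open>m\<close> turns \<open>j \<rightarrow> j - 1 \<rightarrow> j\<close>.  The signs make the two sides of each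
  preprojective relation cancel.
\<close>

fun step :: "nat \<Rightarrow> gen \<Rightarrow> state \<Rightarrow> (int \<times> state) option" where
  "step n (Vertex l) (i, j, m, b) = (if l = j then Some (1, (i, j, m, b)) else None)"
| "step n (Arrow k l) (i, j, m, b) =
     (let i' = (if b then n else i);
          t = (i, l, m + (if j < i' \<and> l = j + 1 \<or> i' < j \<and> j = l + 1 then 1 else 0), b)
      in if k = j \<and> (l = j + 1 \<or> j = l + 1) \<and> valid n t
         then Some (if l = j + 1 then (- 1) ^ j else 1, t) else None)"
| "step n Loop (i, j, m, b) = (if j = n \<and> \<not> b then Some ((- 1) ^ m, (i, j, m, True)) else None)"

text \<open>\<open>F\<close> gives the values of a linear functional on the basis states, and the
  result is its value on the state \<open>s\<close> multiplied by the word. The right module of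
  states thus becomes a left module of functions, and formal combinations of states are avoided. The
  value ring is arbitrary because \<open>F\<close> will also be \<open>nf n\<close>.\<close>

fun act_word :: "nat \<Rightarrow> gen list \<Rightarrow> (state \<Rightarrow> 'a::ring_1) \<Rightarrow> state \<Rightarrow> 'a" where
  "act_word n [] F s = F s"
| "act_word n (g # gs) F s =
     (case step n g s of None \<Rightarrow> 0 | Some (c, t) \<Rightarrow> of_int c * act_word n gs F t)"

definition act :: "nat \<Rightarrow> (gen word \<Rightarrow>\<^sub>0 'k::field) \<Rightarrow> (state \<Rightarrow> 'k) \<Rightarrow> state \<Rightarrow> 'k" where
  "act n f F s = (\<Sum>w\<in>Poly_Mapping.keys f. Poly_Mapping.lookup f w * act_word n (letters w) F s)"

section \<open>Linearity and multiplicativity of the action\<close>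

lemma act_word_append: "act_word n (us @ vs) F s = act_word n us (act_word n vs F) s"
  by (induction us arbitrary: s) (auto split: option.splits)

lemma act_word_add: "act_word n us (\<lambda>t. F t + G t) s = act_word n us F s + act_word n us G s"
  by (induction us arbitrary: s) (auto simp: algebra_simps split: option.splits)

lemma act_word_zero [simp]: "act_word n us (\<lambda>t. 0) s = 0"
  by (induction us arbitrary: s) (auto split: option.splits)

lemma act_word_scale:
  fixes c :: "'a::comm_ring_1"
  shows "act_word n us (\<lambda>t. c * F t) s = c * act_word n us F s"
  by (induction us arbitrary: s) (auto simp: algebra_simps split: option.splits)

lemma valid_step:
  assumes "step n g s = Some (c, t)" "valid n s"
  shows "valid n t"
  using assms by (cases s; cases g) (auto simp: Let_def split: if_splits)

lemma act_word_cong_valid: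
  assumes "valid n s" "\<And>t. valid n t \<Longrightarrow> F t = G t"
  shows "act_word n us F s = act_word n us G s"
  using assms(1)
proof (induction us arbitrary: s)
  case (Cons g us)
  show ?case
  proof (cases "step n g s")
    case (Some ct)
    obtain c t where ct: "ct = (c, t)" by (cases ct)
    with Some have "valid n t"
      using Cons.prems valid_step by blast
    then show ?thesis
      using Some ct by (simp add: Cons.IH)
  qed simp
qed (simp add: assms(2))

lemma act_superset:
  assumes "finite A" "Poly_Mapping.keys f \<subseteq> A"
  shows "act n f F s = (\<Sum>w\<in>A. Poly_Mapping.lookup f w * act_word n (letters w) F s)"
  unfolding act_def by (rule sum.mono_neutral_left) (use assms in \<open>auto simp: in_keys_iff\<close>)

lemma act_zero [simp]: "act n 0 F s = 0"
  by (simp add: act_def)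

lemma act_single [simp]: "act n (Poly_Mapping.single w c) F s = c * act_word n (letters w) F s"
  by (simp add: act_def)

lemma act_add: "act n (f + g) F s = act n f F s + act n g F s"
proof -
  let ?A = "Poly_Mapping.keys f \<union> Poly_Mapping.keys g"
  show ?thesis
    using Poly_Mapping.keys_add [of f g]
    by (simp add: act_superset [of ?A] lookup_add sum.distrib distrib_right)
qed

lemma act_uminus: "act n (- f) F s = - act n f F s"
  using act_add [of n f "- f" F s] by (simp add: add_eq_0_iff)

lemma act_diff: "act n (f - g) F s = act n f F s - act n g F s"
  using act_add [of n f "- g" F s] by (simp add: act_uminus)

lemma act_sum: "act n (\<Sum>x\<in>A. f x) F s = (\<Sum>x\<in>A. act n (f x) F s)"
  by (induction A rule: infinite_finite_induct) (auto simp: act_add)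

lemma act_zero_right [simp]: "act n f (\<lambda>t. 0) s = 0"
  by (simp add: act_def)

lemma act_one [simp]: "act n 1 F s = F s"
  by (simp add: zero_word_def flip: single_one)

lemma act_gen_word [simp]: "act n (gen_word gs) F s = act_word n gs F s"
  by (simp add: gen_word_def)

lemma act_mult: "act n (f * g) F s = act n f (act n g F) s"
proof (induction f rule: poly_mapping_additive_induct)
  case (single u c)
  show ?case
  proof (induction g rule: poly_mapping_additive_induct)
    case (single v d)
    have "act n (Poly_Mapping.single v d) F = (\<lambda>t. d * act_word n (letters v) F t)"
      by (rule ext) simp
    then show ?case
      by (simp add: mult_single plus_word_def act_word_append act_word_scale)
  next
    case (add g h)
    have "act n (g + h) F = (\<lambda>t. act n g F t + act n h F t)"
      by (rule ext) (simp add: act_add)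
    with add show ?case
      by (simp add: act_word_add act_add distrib_left)
  next
    case zero
    have "act n (0 :: gen word \<Rightarrow>\<^sub>0 'a) F = (\<lambda>t. 0)" by (rule ext) simp
    then show ?case by simp
  qed
qed (simp_all add: act_add distrib_right)

lemma act_cong_valid:
  assumes "valid n s" "\<And>t. valid n t \<Longrightarrow> F t = G t"
  shows "act n f F s = act n f G s"
  unfolding act_def by (intro sum.cong refl arg_cong2 [where f = times] act_word_cong_valid assms)

text \<open>In a preprojective relation at \<open>j\<close>, both detours lead to the same state
  with \<open>m + 1\<close> turns, or both vanish, and their signs \<open>(- 1) ^ j\<close> and
  \<open>(- 1) ^ (j - 1)\<close> are opposite. In the relation with the loop, the turn comes before
  or after the loop, which gives the opposite signs \<open>(- 1) ^ (m + 1)\<close> and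
  \<open>(- 1) ^ m\<close>. At vertex 1 a detour would need a turn, and no valid state there has
  one.\<close>

lemma act_relation:
  assumes "n \<ge> 2" "r \<in> relations n" "valid n s"
  shows "act n r F s = 0"
proof -
  obtain i j m b where s: "s = (i, j, m, b)" by (cases s)
  have v: "1 \<le> i" "i \<le> n" "1 \<le> j" "j \<le> n" "m < i" "m < j"
    using assms(3) by (auto simp: s)
  consider
    (idem) l where "r = gen_word [Vertex l, Vertex l] - gen_word [Vertex l]"
  | (orth) l k where "l \<noteq> k" "r = gen_word [Vertex l, Vertex k]"
  | (unit) "r = (\<Sum>i\<in>{1..n}. gen_word [Vertex i]) - 1"
  | (arrow) k l where "r = gen_word [Vertex k, Arrow k l, Vertex l] - gen_word [Arrow k l]"
  | (loop) "r = gen_word [Vertex n, Loop, Vertex n] - gen_word [Loop]"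
  | (nil) "r = gen_word [Loop, Loop]"
  | (first) "r = gen_word [Arrow 1 2, Arrow 2 1]"
  | (mid) k where "2 \<le> k" "k \<le> n - 1"
      "r = gen_word [Arrow k (k + 1), Arrow (k + 1) k] + gen_word [Arrow k (k - 1), Arrow (k - 1) k]"
  | (last) "r = gen_word [Arrow n (n - 1), Arrow (n - 1) n, Loop]
              + gen_word [Loop, Arrow n (n - 1), Arrow (n - 1) n]"
    using assms(2) unfolding relations_def by blast
  then show ?thesis
  proof cases
    case unit
    have "(\<Sum>l\<in>{1..n}. act_word n [Vertex l] F s) = (\<Sum>l\<in>{1..n}. if l = j then F s else 0)"
      by (rule sum.cong) (auto simp: s)
    then show ?thesis
      using unit v by (simp add: act_diff act_sum)
  next
    case mid
    show ?thesis
    proof (cases "k = j")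
      case True
      then obtain p where p: "j = Suc p" "p > 0"
        using mid(1) by (cases j) auto
      have r: "r = gen_word [Arrow (Suc p) (Suc (Suc p)), Arrow (Suc (Suc p)) (Suc p)]
                 + gen_word [Arrow (Suc p) p, Arrow p (Suc p)]"
        using mid(3) True p by simp
      have s': "s = (i, Suc p, m, b)" and "0 < i" "i \<le> n" "Suc p < n" "m < i" "m < Suc p" "0 < p"
        using s v p mid True by simp_all
      show ?thesis
      proof (cases b)
        case True
        show ?thesis
          unfolding r s' using True \<open>0 < i\<close> \<open>i \<le> n\<close> \<open>Suc p < n\<close> \<open>m < i\<close> \<open>m < Suc p\<close> \<open>0 < p\<close>
          \<comment> \<open>These comparisons decide whether the common target, with
            \<open>Suc m\<close> turns, is valid.\<close>
          by (cases "Suc m < i"; cases "m < p") (simp_all add: act_add)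
      next
        case False
        show ?thesis
          unfolding r s' using False \<open>0 < i\<close> \<open>i \<le> n\<close> \<open>Suc p < n\<close> \<open>m < i\<close> \<open>m < Suc p\<close> \<open>0 < p\<close>
          by (cases i "Suc p" rule: linorder_cases; cases "Suc m < i"; cases "m < p") (simp_all add: act_add)
      qed
    next
      case False
      then show ?thesis
        using mid by (simp add: s act_add)
    qed
  next
    case last
    obtain p where p: "n = Suc p" "p > 0"
      using assms(1) by (cases n) auto
    show ?thesis
    proof (cases "j = n \<and> \<not> b")
      case True
      then show ?thesis
        using v p last by (cases "i = n"; cases "m < p"; cases "Suc m < i")
          (simp_all add: s act_add Let_def)
    next
      case False
      then show ?thesis
        using v p last by (cases b) (simp_all add: s act_add Let_def)
    qed
  next
    case arrow
    then show ?thesis by (auto simp: s act_diff Let_def)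
  qed (use v in \<open>simp_all add: s act_diff Let_def\<close>)
qed

text \<open>The annihilator of a module is a two-sided ideal, so it contains the whole ideal as soon
  as it contains the relations.\<close>

lemma act_rel_ideal:
  fixes f :: "gen word \<Rightarrow>\<^sub>0 'k::field"
  assumes "n \<ge> 2" "f \<in> rel_ideal TYPE('k) n" "valid n s"
  shows "act n f F s = 0"
proof -
  interpret ring "free_algebra (gens n) :: (gen word \<Rightarrow>\<^sub>0 'k) ring"
    by (rule ring_free_algebra)
  let ?A = "free_algebra (gens n) :: (gen word \<Rightarrow>\<^sub>0 'k) ring"
  let ?N = "{f \<in> carrier ?A. \<forall>F s. valid n s \<longrightarrow> act n f F s = 0}"
  have "ideal ?N ?A"
  proof (rule idealI)
    show "subgroup ?N (add_monoid ?A)"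
    proof (rule add.subgroupI)
      show "?N \<noteq> {}" using zero_closed by (auto intro: exI [of _ 0])
    next
      fix a assume a: "a \<in> ?N"
      then have "\<ominus>\<^bsub>?A\<^esub> a + a = 0" using l_neg [of a] by simp
      then have "\<ominus>\<^bsub>?A\<^esub> a = - a" by (simp add: add_eq_0_iff2)
      with a show "\<ominus>\<^bsub>?A\<^esub> a \<in> ?N" using a_inv_closed [of a] by (auto simp: act_uminus)
    next
      fix a b assume "a \<in> ?N" "b \<in> ?N"
      then show "a \<oplus>\<^bsub>?A\<^esub> b \<in> ?N" using a_closed [of a b] by (auto simp: act_add)
    qed auto
  next
    fix a x assume ax: "a \<in> ?N" "x \<in> carrier ?A"
    then have *: "act n a F s = 0" if "valid n s" for F s using that by blast
    \<comment> \<open>The inner function vanishes on valid states only. This is enough because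
      \<open>step\<close> never leaves them.\<close>
    then have "act n x (act n a F) s = 0" if "valid n s" for F s
      using act_cong_valid [of n s "act n a F" "\<lambda>_. 0"] that by simp
    with * show "x \<otimes>\<^bsub>?A\<^esub> a \<in> ?N" "a \<otimes>\<^bsub>?A\<^esub> x \<in> ?N"
      using m_closed [of a x] m_closed [of x a] ax by (simp_all add: act_mult del: valid.simps)
  qed (rule ring_free_algebra)
  moreover have "relations n \<subseteq> ?N"
    using act_relation assms(1) relations_closed [OF assms(1)] by blast
  ultimately have "rel_ideal TYPE('k) n \<subseteq> ?N"
    unfolding rel_ideal_def by (rule genideal_minimal)
  with assms show ?thesis by blast
qed

section \<open>Congruence modulo the relations\<close>

text \<open>
  Killing the words that use generators outside \<open>gens n\<close> extends the congruence to the whole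
  type, so that no carrier conditions arise when computing with it.
\<close>

definition restrict_gens :: "nat \<Rightarrow> (gen word \<Rightarrow>\<^sub>0 'k::field) \<Rightarrow> gen word \<Rightarrow>\<^sub>0 'k" where
  "restrict_gens n f = Poly_Mapping.mapp (\<lambda>w c. c when set (letters w) \<subseteq> gens n) f"

definition eqv :: "nat \<Rightarrow> (gen word \<Rightarrow>\<^sub>0 'k::field) \<Rightarrow> (gen word \<Rightarrow>\<^sub>0 'k) \<Rightarrow> bool" where
  "eqv n f g \<longleftrightarrow> restrict_gens n (f - g) \<in> rel_ideal TYPE('k) n"

lemma lookup_restrict_gens:
  "Poly_Mapping.lookup (restrict_gens n f) w = (Poly_Mapping.lookup f w when set (letters w) \<subseteq> gens n)"
  by (simp add: restrict_gens_def lookup_mapp when_def in_keys_iff)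

lemma restrict_gens_zero [simp]: "restrict_gens n 0 = 0"
  by (rule poly_mapping_eqI) (simp add: lookup_restrict_gens)

lemma restrict_gens_add: "restrict_gens n (f + g) = restrict_gens n f + restrict_gens n g"
  by (rule poly_mapping_eqI) (simp add: lookup_restrict_gens lookup_add when_add_distrib)

lemma restrict_gens_single:
  "restrict_gens n (Poly_Mapping.single w c) =
     (if set (letters w) \<subseteq> gens n then Poly_Mapping.single w c else 0)"
  by (rule poly_mapping_eqI) (auto simp: lookup_restrict_gens lookup_single when_def)

text \<open>A concatenation uses only letters from \<open>gens n\<close> exactly when both words do.
  Hence the truncation is a ring homomorphism, and \<open>eqv\<close> becomes compatible with
  products on the whole type.\<close>

lemma restrict_gens_mult: "restrict_gens n (f * g) = restrict_gens n f * restrict_gens n g"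
proof (induction f rule: poly_mapping_additive_induct)
  case (single u c)
  show ?case
    by (induction g rule: poly_mapping_additive_induct)
      (simp_all add: restrict_gens_add restrict_gens_single distrib_left mult_single plus_word_def)
qed (simp_all add: restrict_gens_add distrib_right)

lemma restrict_gens_id: "f \<in> carrier (free_algebra (gens n)) \<Longrightarrow> restrict_gens n f = f"
  by (rule poly_mapping_eqI)
    (auto simp: lookup_restrict_gens free_algebra_def when_def in_keys_iff)

lemma restrict_gens_closed: "restrict_gens n f \<in> carrier (free_algebra (gens n))"
  by (auto simp: free_algebra_def in_keys_iff lookup_restrict_gens)

section \<open>Normal forms\<close>

lemma gen_word_append: "gen_word (us @ vs) = gen_word us * gen_word vs"
  by (simp add: gen_word_def mult_single plus_word_def)

lemma gen_word_Cons2: "gen_word (u # v # vs) = gen_word [u] * gen_word (v # vs)"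
  using gen_word_append [of "[u]" "v # vs"] by simp

definition vert :: "nat \<Rightarrow> gen word \<Rightarrow>\<^sub>0 'k::field" where
  "vert i = gen_word [Vertex i]"

text \<open>
  The signs turn the preprojective relations into commutation relations
  \<open>up j * down j = down (j - 1) * up (j - 1)\<close>.
\<close>

definition up :: "nat \<Rightarrow> gen word \<Rightarrow>\<^sub>0 'k::field" where
  "up j = (- 1) ^ j * gen_word [Arrow j (Suc j)]"

definition down :: "nat \<Rightarrow> gen word \<Rightarrow>\<^sub>0 'k::field" where
  "down j = gen_word [Arrow (Suc j) j]"

text \<open>The component of z at the vertex \<open>j\<close>. For \<open>j = 1\<close> it passes
  through the missing vertex 0, so that \<open>eqv\<close> identifies it with 0.\<close>

definition turn :: "nat \<Rightarrow> gen word \<Rightarrow>\<^sub>0 'k::field" where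
  "turn j = down (j - 1) * up (j - 1)"

definition loop :: "gen word \<Rightarrow>\<^sub>0 'k::field" where
  "loop = gen_word [Loop]"

fun ascent :: "nat \<Rightarrow> nat \<Rightarrow> gen word \<Rightarrow>\<^sub>0 'k::field" where
  "ascent i 0 = vert i"
| "ascent i (Suc d) = ascent i d * up (i + d)"

fun descent :: "nat \<Rightarrow> nat \<Rightarrow> gen word \<Rightarrow>\<^sub>0 'k::field" where
  "descent i 0 = vert i"
| "descent i (Suc d) = descent i d * down (i - Suc d)"

definition straight :: "nat \<Rightarrow> nat \<Rightarrow> gen word \<Rightarrow>\<^sub>0 'k::field" where
  "straight i j = (if i \<le> j then ascent i (j - i) else descent i (i - j))"

definition core :: "nat \<Rightarrow> nat \<Rightarrow> nat \<Rightarrow> bool \<Rightarrow> gen word \<Rightarrow>\<^sub>0 'k::field" where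
  "core n i j b = (if b then straight i n * loop * straight n j else straight i j)"

fun nf :: "nat \<Rightarrow> state \<Rightarrow> gen word \<Rightarrow>\<^sub>0 'k::field" where
  "nf n (i, j, m, b) = core n i j b * turn j ^ m"

lemma straight_refl [simp]: "straight i i = vert i"
  by (simp add: straight_def)

lemma straight_up: "i \<le> j \<Longrightarrow> straight i (Suc j) = straight i j * up j"
  by (simp add: straight_def Suc_diff_le)

lemma straight_down: "j < i \<Longrightarrow> straight i (Suc j) * down j = straight i j"
proof -
  assume *: "j < i"
  then obtain d where "i = Suc (j + d)" by (metis less_iff_Suc_add)
  then show ?thesis by (cases d) (simp_all add: straight_def)
qed

text \<open>The descending path to \<open>j\<close> ends with \<open>down j\<close>, and the arrow
  back completes a turn at \<open>Suc j\<close>; no relation is involved.\<close>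

lemma straight_up_back: "j < i \<Longrightarrow> straight i j * up j = straight i (Suc j) * turn (Suc j)"
  by (simp add: turn_def mult.assoc flip: straight_down)

lemma minus_one_power_mult_commute: "(- 1) ^ m * x = x * (- 1) ^ m" for x :: "'a::ring_1"
  by (cases "even m") simp_all

lemma up_sign: "gen_word [Arrow j (Suc j)] = (- 1) ^ j * up j"
  by (cases "even j") (simp_all add: up_def)

locale linear_quiver =
  fixes n :: nat
  assumes n: "n \<ge> 2"
begin

section \<open>Congruence calculus for the relation ideal\<close>

lemma ideal_rel_ideal: "ideal (rel_ideal TYPE('k::field) n) (free_algebra (gens n))"
  unfolding rel_ideal_def by (intro ring.genideal_ideal ring_free_algebra relations_closed n)

abbreviation eqv_n :: "(gen word \<Rightarrow>\<^sub>0 'k::field) \<Rightarrow> (gen word \<Rightarrow>\<^sub>0 'k) \<Rightarrow> bool" (infix \<open>\<approx>\<close> 50) where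
  "f \<approx> g \<equiv> eqv n f g"

lemma rel_ideal_add:
  "f \<in> rel_ideal TYPE('k::field) n \<Longrightarrow> g \<in> rel_ideal TYPE('k) n \<Longrightarrow> f + g \<in> rel_ideal TYPE('k) n"
  using additive_subgroup.a_closed [OF ideal.axioms(1) [OF ideal_rel_ideal]] by fastforce

lemma rel_ideal_mult:
  assumes "f \<in> rel_ideal TYPE('k::field) n"
  shows "restrict_gens n g * f \<in> rel_ideal TYPE('k) n" "f * restrict_gens n g \<in> rel_ideal TYPE('k) n"
  using ideal.I_l_closed [OF ideal_rel_ideal assms restrict_gens_closed [of n g]]
    ideal.I_r_closed [OF ideal_rel_ideal assms restrict_gens_closed [of n g]] by simp_all

lemma eqv_refl [simp, intro]: "f \<approx> f"
  using additive_subgroup.zero_closed [OF ideal.axioms(1) [OF ideal_rel_ideal]]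
  by (simp add: eqv_def)

lemma eqv_add: "a \<approx> b \<Longrightarrow> c \<approx> d \<Longrightarrow> a + c \<approx> b + d"
  using rel_ideal_add by (force simp: eqv_def add_diff_add restrict_gens_add)

lemma eqv_mult_left:
  assumes "a \<approx> b"
  shows "c * a \<approx> c * b"
  using rel_ideal_mult assms
  by (force simp: eqv_def restrict_gens_mult simp flip: right_diff_distrib)

lemma eqv_mult_right:
  assumes "a \<approx> b"
  shows "a * c \<approx> b * c"
  using rel_ideal_mult assms
  by (force simp: eqv_def restrict_gens_mult simp flip: left_diff_distrib)

lemma eqv_trans [trans]: "a \<approx> b \<Longrightarrow> b \<approx> c \<Longrightarrow> a \<approx> c"
  using rel_ideal_add [of "restrict_gens n (a - b)" "restrict_gens n (b - c)"]
  by (simp add: eqv_def flip: restrict_gens_add)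

lemma eqv_uminus: "a \<approx> b \<Longrightarrow> - a \<approx> - b"
  using eqv_mult_left [of a b "- 1"] by simp

lemma eqv_sym: "a \<approx> b \<Longrightarrow> b \<approx> a"
  using eqv_uminus [of a b] by (simp add: eqv_def)

lemma eqv_mult: "a \<approx> b \<Longrightarrow> c \<approx> d \<Longrightarrow> a * c \<approx> b * d"
  using eqv_trans eqv_mult_left eqv_mult_right by blast

lemma eqv_mult_zero_left: "a \<approx> 0 \<Longrightarrow> c * a \<approx> 0"
  using eqv_mult_left [of a 0 c] by simp

lemma eqv_mult_zero_right: "a \<approx> 0 \<Longrightarrow> a * c \<approx> 0"
  using eqv_mult_right [of a 0 c] by simp

lemma eqv_relation:
  fixes r :: "gen word \<Rightarrow>\<^sub>0 'k::field"
  assumes "r \<in> relations n"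
  shows "r \<approx> 0"
proof -
  have "r \<in> carrier (free_algebra (gens n))"
    using relations_closed [OF n] assms by blast
  moreover have "r \<in> rel_ideal TYPE('k) n"
    unfolding rel_ideal_def
    using ring.genideal_self [OF ring_free_algebra relations_closed [OF n]] assms by blast
  ultimately show ?thesis
    by (simp add: eqv_def restrict_gens_id)
qed

lemma eqv_not_gen: "g \<notin> gens n \<Longrightarrow> gen_word [g] \<approx> 0"
  using additive_subgroup.zero_closed [OF ideal.axioms(1) [OF ideal_rel_ideal]]
  by (simp add: eqv_def gen_word_def restrict_gens_single)

lemma eqv_iff_diff: "a \<approx> b \<longleftrightarrow> a - b \<approx> 0"
  by (simp add: eqv_def)

lemma eqv_commute_power:
  assumes "a * b \<approx> b * c"
  shows "a ^ m * b \<approx> b * c ^ m"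
proof (induction m)
  case (Suc m)
  have "a ^ Suc m * b = a * (a ^ m * b)" by (simp add: mult.assoc)
  also have "\<dots> \<approx> a * (b * c ^ m)" by (intro eqv_mult_left Suc)
  also have "\<dots> = (a * b) * c ^ m" by (simp add: mult.assoc)
  also have "\<dots> \<approx> (b * c) * c ^ m" by (intro eqv_mult_right assms)
  finally show ?case by (simp add: mult.assoc)
qed simp


section \<open>The relations as congruences between signed generators\<close>

lemma vert_idem: "i \<in> {1..n} \<Longrightarrow> vert i * vert i \<approx> vert i"
  unfolding vert_def gen_word_Cons2 [symmetric]
  by (subst eqv_iff_diff, rule eqv_relation) (auto simp: relations_def)

lemma vert_orth: "i \<in> {1..n} \<Longrightarrow> j \<in> {1..n} \<Longrightarrow> i \<noteq> j \<Longrightarrow> vert i * vert j \<approx> 0"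
  unfolding vert_def gen_word_Cons2 [symmetric]
  by (rule eqv_relation) (auto simp: relations_def)

lemma eqv_absorb:
  assumes "e * a * f \<approx> a" "e * e \<approx> e" "f * f \<approx> f"
  shows "e * a \<approx> a" "a * f \<approx> a"
proof -
  have "e * a \<approx> e * (e * a * f)"
    by (intro eqv_mult_left eqv_sym [OF assms(1)])
  also have "\<dots> = (e * e) * (a * f)" by (simp add: mult.assoc)
  also have "\<dots> \<approx> e * (a * f)" by (intro eqv_mult_right assms)
  also have "\<dots> = e * a * f" by (simp add: mult.assoc)
  also note assms(1)
  finally show "e * a \<approx> a" .
  have "a * f \<approx> (e * a * f) * f"
    by (intro eqv_mult_right eqv_sym [OF assms(1)])
  also have "\<dots> = (e * a) * (f * f)" by (simp add: mult.assoc)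
  also have "\<dots> \<approx> (e * a) * f" by (intro eqv_mult_left assms)
  also note assms(1)
  finally show "a * f \<approx> a" .
qed

lemma vert_arrow:
  assumes "(i, j) \<in> arrows n"
  shows "vert i * gen_word [Arrow i j] \<approx> gen_word [Arrow i j]"
    "gen_word [Arrow i j] * vert j \<approx> gen_word [Arrow i j]"
proof -
  have "gen_word [Vertex i, Arrow i j, Vertex j] - gen_word [Arrow i j] \<approx> 0"
    by (rule eqv_relation) (use assms in \<open>auto simp: relations_def\<close>)
  then have "vert i * gen_word [Arrow i j] * vert j \<approx> gen_word [Arrow i j]"
    by (subst eqv_iff_diff) (simp add: vert_def gen_word_Cons2 mult.assoc)
  moreover have "i \<in> {1..n}" "j \<in> {1..n}"
    using assms by (auto simp: arrows_def)
  ultimately show "vert i * gen_word [Arrow i j] \<approx> gen_word [Arrow i j]"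
    "gen_word [Arrow i j] * vert j \<approx> gen_word [Arrow i j]"
    by (metis eqv_absorb vert_idem)+
qed

lemma vert_down:
  assumes "j \<in> {1..<n}"
  shows "vert (Suc j) * down j \<approx> down j" "down j * vert j \<approx> down j"
  unfolding down_def using vert_arrow [of "Suc j" j] assms by (auto simp: arrows_def)

lemma vert_up:
  assumes "j \<in> {1..<n}"
  shows "vert j * up j \<approx> up j" "up j * vert (Suc j) \<approx> up j"
proof -
  have *: "vert j * gen_word [Arrow j (Suc j)] \<approx> gen_word [Arrow j (Suc j)]"
    "gen_word [Arrow j (Suc j)] * vert (Suc j) \<approx> gen_word [Arrow j (Suc j)]"
    using vert_arrow [of j "Suc j"] assms by (auto simp: arrows_def)
  show "vert j * up j \<approx> up j"
    using eqv_mult_left [OF *(1), of "(- 1) ^ j"]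
    by (metis minus_one_power_mult_commute mult.assoc up_def)
  show "up j * vert (Suc j) \<approx> up j"
    using eqv_mult_left [OF *(2), of "(- 1) ^ j"] by (simp add: up_def mult.assoc)
qed

lemma vert_loop: "vert n * loop \<approx> loop" "loop * vert n \<approx> loop"
proof -
  have "gen_word [Vertex n, Loop, Vertex n] - gen_word [Loop] \<approx> 0"
    by (rule eqv_relation) (auto simp: relations_def)
  then have "vert n * loop * vert n \<approx> loop"
    by (subst eqv_iff_diff) (simp add: vert_def loop_def gen_word_Cons2 mult.assoc)
  moreover have "n \<in> {1..n}"
    using n by simp
  ultimately show "vert n * loop \<approx> loop" "loop * vert n \<approx> loop"
    by (metis eqv_absorb vert_idem)+
qed

lemma loop_square: "loop * loop \<approx> 0"
  unfolding loop_def gen_word_Cons2 [symmetric]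
  by (rule eqv_relation) (auto simp: relations_def)

lemma turn_1: "turn 1 \<approx> 0"
  unfolding turn_def down_def
  by (rule eqv_mult_zero_right, rule eqv_not_gen) (auto simp: gens_def arrows_def)

lemma up_down:
  assumes "j \<in> {1..<n}"
  shows "up j * down j \<approx> (turn j :: gen word \<Rightarrow>\<^sub>0 'k::field)"
proof (cases "j = 1")
  \<comment> \<open>At vertex 1 both sides vanish: the left one by its relation, the right one
    because it passes through vertex 0.\<close>
  case True
  have "gen_word [Arrow 1 2, Arrow 2 1] \<approx> 0"
    by (rule eqv_relation) (auto simp: relations_def)
  then have "up 1 * down 1 \<approx> 0"
    using eqv_mult_left [of "gen_word [Arrow 1 2, Arrow 2 1]" 0 "- 1"]
    by (simp add: up_def down_def gen_word_Cons2 numeral_2_eq_2)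
  with turn_1 True show ?thesis
    using eqv_sym eqv_trans by blast
next
  case False
  then obtain p where p: "j = Suc p" "p > 0"
    using assms by (cases j) auto
  let ?r = "gen_word [Arrow j (j + 1), Arrow (j + 1) j] + gen_word [Arrow j (j - 1), Arrow (j - 1) j]
    :: gen word \<Rightarrow>\<^sub>0 'k"
  have "?r \<approx> 0"
    by (rule eqv_relation, unfold relations_def, rule UnI1, rule UnI2, rule CollectI)
      (use p assms in \<open>auto intro: exI [of _ j]\<close>)
  then have "(- 1) ^ j * ?r \<approx> 0"
    by (rule eqv_mult_zero_left)
  \<comment> \<open>The signs in \<open>up j\<close> and in \<open>up (j - 1)\<close> are opposite,
    which turns the sum into a difference.\<close>
  also have "(- 1) ^ j * ?r = up j * down j - turn j"
    using p by (cases "even p") (simp_all add: up_def down_def turn_def gen_word_Cons2 algebra_simps)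
  finally show ?thesis
    by (subst eqv_iff_diff)
qed

lemma turn_Suc: "turn (Suc j) = down j * up j"
  by (simp add: turn_def)

text \<open>This is the commutation of z with an arrow: for \<open>m = 1\<close> both sides are
  congruent to \<open>up j * down j * up j\<close>.\<close>

lemma turn_up:
  assumes "j \<in> {1..<n}"
  shows "turn j ^ m * up j \<approx> up j * turn (Suc j) ^ m"
  using eqv_sym [OF eqv_mult_right [OF up_down [OF assms], of "up j"]]
  by (intro eqv_commute_power) (simp add: turn_Suc mult.assoc)

lemma turn_down:
  assumes "j \<in> {1..<n}"
  shows "turn (Suc j) ^ m * down j \<approx> down j * turn j ^ m"
  using eqv_mult_left [OF up_down [OF assms], of "down j"]
  by (intro eqv_commute_power) (simp add: turn_Suc mult.assoc)

lemma turn_loop: "turn n ^ m * loop \<approx> (- 1) ^ m * (loop * turn n ^ m :: gen word \<Rightarrow>\<^sub>0 'k::field)"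
proof -
  obtain p where p: "n = Suc p" using n by (cases n) auto
  let ?r = "gen_word [Arrow n (n - 1), Arrow (n - 1) n, Loop]
        + gen_word [Loop, Arrow n (n - 1), Arrow (n - 1) n] :: gen word \<Rightarrow>\<^sub>0 'k"
  have "?r \<approx> 0"
    by (rule eqv_relation) (auto simp: relations_def)
  \<comment> \<open>Since \<open>p\<close> is \<open>n - 1\<close>, this is the sign hidden in
    \<open>turn n\<close>.\<close>
  then have "(- 1) ^ p * ?r \<approx> 0"
    by (rule eqv_mult_zero_left)
  also have "(- 1) ^ p * ?r = turn n * loop - loop * (- turn n)"
    using p by (cases "even p") (simp_all add: up_def down_def turn_def loop_def gen_word_Cons2 algebra_simps)
  finally have "turn n * loop \<approx> loop * (- turn n :: gen word \<Rightarrow>\<^sub>0 'k)"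
    by (subst eqv_iff_diff)
  then have "turn n ^ m * loop \<approx> loop * (- turn n :: gen word \<Rightarrow>\<^sub>0 'k) ^ m"
    by (rule eqv_commute_power)
  also have "\<dots> = (- 1) ^ m * (loop * turn n ^ m)"
    by (cases "even m") simp_all
  finally show ?thesis .
qed

text \<open>A turn begins and ends at \<open>j\<close>. The statement is a commutation and not an
  absorption because \<open>turn j ^ 0\<close> is the unit of the free algebra, not
  \<open>vert j\<close>.\<close>

lemma turn_vert:
  assumes "j \<in> {1..n}"
  shows "turn j ^ m * vert j \<approx> vert j * turn j ^ m"
proof (rule eqv_commute_power, cases "j = 1")
  case True
  then show "turn j * vert j \<approx> vert j * turn j"
    using eqv_mult_zero_left [OF turn_1] eqv_mult_zero_right [OF turn_1] eqv_sym eqv_trans by metis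
next
  case False
  then obtain p where p: "j = Suc p" "p \<in> {1..<n}"
    using assms by (cases j) auto
  have "turn j * vert j = down p * (up p * vert j)"
    by (simp add: p turn_Suc mult.assoc)
  also have "\<dots> \<approx> down p * up p"
    unfolding p by (intro eqv_mult_left vert_up p)
  also have "\<dots> \<approx> (vert j * down p) * up p"
    unfolding p by (intro eqv_mult_right eqv_sym [OF vert_down(1)] p)
  finally show "turn j * vert j \<approx> vert j * turn j"
    by (simp add: p turn_Suc mult.assoc)
qed

text \<open>Split the last turn at \<open>Suc j\<close> into \<open>down j * up j\<close>. The
  remaining \<open>j\<close> turns slide along \<open>down j\<close> to the vertex \<open>j\<close>,
  where the induction hypothesis kills them.\<close>

lemma vert_turn_nilpotent:
  assumes "j \<in> {1..n}"
  shows "vert j * turn j ^ j \<approx> (0 :: gen word \<Rightarrow>\<^sub>0 'k::field)"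
  using assms
proof (induction j)
  case (Suc j)
  show ?case
  proof (cases "j = 0")
    case True
    then show ?thesis
      using eqv_mult_zero_left [OF turn_1] by simp
  next
    case False
    with Suc.prems have j: "j \<in> {1..<n}" by simp
    have "vert (Suc j) * turn (Suc j) ^ Suc j =
        vert (Suc j) * (turn (Suc j) ^ j * down j) * (up j :: gen word \<Rightarrow>\<^sub>0 'k)"
      by (simp add: turn_Suc mult.assoc flip: power_Suc2 del: power_Suc)
    also have "\<dots> \<approx> vert (Suc j) * (down j * turn j ^ j) * up j"
      by (intro eqv_mult_right eqv_mult_left turn_down j)
    also have "\<dots> \<approx> vert (Suc j) * ((down j * vert j) * turn j ^ j) * up j"
      by (intro eqv_mult_right eqv_mult_left eqv_sym [OF vert_down(2)] j)
    also have "\<dots> = vert (Suc j) * down j * (vert j * turn j ^ j) * up j"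
      by (simp add: mult.assoc)
    also have "\<dots> \<approx> 0"
      by (rule eqv_mult_zero_right, rule eqv_mult_zero_left) (use Suc.IH j in auto)
    finally show ?thesis .
  qed
qed simp

text \<open>The flag \<open>b\<close> records whether \<open>a\<close> contains the loop, which anticommutes with turns.\<close>

definition transports :: "nat \<Rightarrow> nat \<Rightarrow> bool \<Rightarrow> (gen word \<Rightarrow>\<^sub>0 'k::field) \<Rightarrow> bool" where
  "transports i j b a \<longleftrightarrow>
     vert i * a \<approx> a \<and> a * vert j \<approx> a \<and>
     (\<forall>m. turn i ^ m * a \<approx> (if b then (- 1) ^ m else 1) * (a * turn j ^ m))"

lemma transports_vert: "j \<in> {1..n} \<Longrightarrow> transports j j False (vert j)"
  by (simp add: transports_def vert_idem turn_vert)

lemma transports_up: "j \<in> {1..<n} \<Longrightarrow> transports j (Suc j) False (up j)"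
  by (simp add: transports_def vert_up turn_up)

lemma transports_down: "j \<in> {1..<n} \<Longrightarrow> transports (Suc j) j False (down j)"
  by (simp add: transports_def vert_down turn_down)

lemma transports_loop: "transports n n True loop"
  by (simp add: transports_def vert_loop turn_loop)

text \<open>Two loops are excluded because their signs would cancel, while the flag of the product
  would still demand the sign.\<close>

lemma transports_mult:
  fixes a c :: "gen word \<Rightarrow>\<^sub>0 'k::field"
  assumes a: "transports i j b a" and c: "transports j k b' c" and "\<not> (b \<and> b')"
  shows "transports i k (b \<or> b') (a * c)"
  unfolding transports_def
proof (intro conjI allI)
  let ?s = "\<lambda>b m. if b then (- 1) ^ m else 1 :: gen word \<Rightarrow>\<^sub>0 'k"
  have a': "vert i * a \<approx> a" "turn i ^ m * a \<approx> ?s b m * (a * turn j ^ m)" for m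
    using a unfolding transports_def by blast+
  have c': "c * vert k \<approx> c" "turn j ^ m * c \<approx> ?s b' m * (c * turn k ^ m)" for m
    using c unfolding transports_def by blast+
  show "vert i * (a * c) \<approx> a * c"
    using eqv_mult_right [OF a'(1), of c] by (simp add: mult.assoc)
  show "a * c * vert k \<approx> a * c"
    using eqv_mult_left [OF c'(1), of a] by (simp add: mult.assoc)
  fix m
  have "turn i ^ m * (a * c) \<approx> ?s b m * (a * turn j ^ m) * c"
    using eqv_mult_right [OF a'(2), of m c] by (simp add: mult.assoc)
  also have "\<dots> = ?s b m * a * (turn j ^ m * c)"
    by (simp add: mult.assoc)
  also have "\<dots> \<approx> ?s b m * a * (?s b' m * (c * turn k ^ m))"
    by (intro eqv_mult_left c')
  also have "\<dots> = ?s (b \<or> b') m * (a * c * turn k ^ m)"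
    using assms(3) by (cases "even m"; cases b; cases b') (simp_all add: mult.assoc)
  finally show "turn i ^ m * (a * c) \<approx> ?s (b \<or> b') m * (a * c * turn k ^ m)" .
qed

section \<open>Passing turns through straight paths and through the loop\<close>

lemma transports_straight:
  assumes "i \<in> {1..n}" "j \<in> {1..n}"
  shows "transports i j False (straight i j)"
proof (cases i j rule: le_cases)
  case le
  then show ?thesis using assms(2)
  proof (induction j rule: dec_induct)
    case base
    then show ?case by (simp add: transports_vert)
  next
    case (step j)
    then show ?case
      using transports_mult [of i j False "straight i j" "Suc j" False "up j"] assms(1)
      by (simp add: straight_up transports_up)
  qed
next
  case ge
  then show ?thesis using assms(2)
  proof (induction j rule: inc_induct)
    case base
    then show ?case by (simp add: transports_vert)
  next
    case (step j)
    then show ?case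
      using transports_mult [of i "Suc j" False "straight i (Suc j)" j False "down j"] assms(1)
      by (simp add: straight_down transports_down)
  qed
qed

lemma transports_core:
  assumes "i \<in> {1..n}" "j \<in> {1..n}"
  shows "transports i j b (core n i j b)"
proof (cases b)
  case True
  have "n \<in> {1..n}" using n by simp
  with True assms show ?thesis
    using transports_mult [OF transports_mult [OF transports_straight transports_loop] transports_straight, of i j]
    by (simp add: core_def)
next
  case False
  with assms show ?thesis by (simp add: core_def transports_straight)
qed

text \<open>The last straight part starts at \<open>i\<close>, or at \<open>n\<close> if there is a
  loop. An arrow towards that start retraces the part and creates one turn; an arrow away from it
  just prolongs the path.\<close>

lemma core_up:
  assumes "j \<in> {1..<n}"
  shows "core n i j b * up j =
    core n i (Suc j) b * turn (Suc j) ^ (if j < (if b then n else i) then 1 else 0)"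
  using assms
  by (cases b) (auto simp: core_def mult.assoc straight_up_back straight_up)

lemma core_down:
  assumes "i \<in> {1..n}" "j \<in> {1..<n}"
  shows "core n i (Suc j) b * down j \<approx>
    core n i j b * (turn j :: gen word \<Rightarrow>\<^sub>0 'k::field) ^ (if (if b then n else i) < Suc j then 1 else 0)"
proof (cases "j < (if b then n else i)")
  case True
  then have "core n i (Suc j) b * down j = (core n i j b :: gen word \<Rightarrow>\<^sub>0 'k)"
    by (cases b) (auto simp: core_def mult.assoc straight_down)
  with True show ?thesis by auto
next
  case False
  \<comment> \<open>Only an ascent from \<open>i\<close> can be retraced downwards, since after the
    loop the straight part descends from \<open>n\<close>. Here the product
    \<open>up j * down j\<close> has to be rewritten as a turn at \<open>j\<close>.\<close>
  with assms have *: "\<not> b" "i \<le> j"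
    by (auto split: if_splits)
  then show ?thesis
    using eqv_mult_left [OF up_down [OF assms(2)]]
    by (simp add: core_def straight_up mult.assoc)
qed

section \<open>Multiplication of normal forms by generators\<close>

lemma nf_vert:
  assumes "i \<in> {1..n}" "j \<in> {1..n}"
  shows "nf n (i, j, m, b) * vert j \<approx> nf n (i, j, m, b)"
proof -
  have *: "core n i j b * vert j \<approx> core n i j b"
    using transports_core [OF assms, of b] unfolding transports_def by blast
  have "core n i j b * (turn j ^ m * vert j) \<approx> core n i j b * (vert j * turn j ^ m)"
    by (intro eqv_mult_left turn_vert assms)
  also have "\<dots> = (core n i j b * vert j) * turn j ^ m"
    by (simp add: mult.assoc)
  also have "\<dots> \<approx> core n i j b * turn j ^ m"
    by (intro eqv_mult_right *)
  finally show ?thesis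
    by (simp add: mult.assoc)
qed

lemma vert_turn_zero:
  assumes "j \<in> {1..n}" "j \<le> m"
  shows "vert j * turn j ^ m \<approx> 0"
  using eqv_mult_zero_right [OF vert_turn_nilpotent [OF assms(1)], of "turn j ^ (m - j)"] assms(2)
  by (simp add: mult.assoc flip: power_add)

text \<open>If \<open>m\<close> is at least \<open>j\<close>, the turns vanish where they stand, at
  the end of the path. Otherwise \<open>m\<close> is at least \<open>i\<close>, and they vanish
  after being moved to the start.\<close>

lemma nf_zero:
  fixes b :: bool
  assumes "i \<in> {1..n}" "j \<in> {1..n}" "\<not> valid n (i, j, m, b)"
  shows "nf n (i, j, m, b) \<approx> (0 :: gen word \<Rightarrow>\<^sub>0 'k::field)"
proof -
  let ?a = "core n i j b :: gen word \<Rightarrow>\<^sub>0 'k"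
  let ?s = "if b then (- 1) ^ m else 1 :: gen word \<Rightarrow>\<^sub>0 'k"
  have a: "vert i * ?a \<approx> ?a" "?a * vert j \<approx> ?a" "turn i ^ m * ?a \<approx> ?s * (?a * turn j ^ m)"
    using transports_core [OF assms(1,2), of b] unfolding transports_def by blast+
  have "?a * turn j ^ m \<approx> 0"
  proof (cases "j \<le> m")
    case True
    have "?a * turn j ^ m \<approx> (?a * vert j) * turn j ^ m"
      by (intro eqv_mult_right eqv_sym [OF a(2)])
    also have "\<dots> = ?a * (vert j * turn j ^ m)"
      by (simp add: mult.assoc)
    also have "\<dots> \<approx> 0"
      by (intro eqv_mult_zero_left vert_turn_zero assms True)
    finally show ?thesis .
  next
    case False
    have "?s * (?a * turn j ^ m) \<approx> turn i ^ m * ?a"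
      by (rule eqv_sym) (rule a)
    also have "\<dots> \<approx> turn i ^ m * (vert i * ?a)"
      by (intro eqv_mult_left eqv_sym [OF a(1)])
    also have "\<dots> = (turn i ^ m * vert i) * ?a"
      by (simp add: mult.assoc)
    also have "\<dots> \<approx> (vert i * turn i ^ m) * ?a"
      by (intro eqv_mult_right turn_vert assms)
    also have "\<dots> \<approx> 0"
      by (intro eqv_mult_zero_right vert_turn_zero) (use assms False in auto)
    \<comment> \<open>The sign squares to 1, so a second factor removes it.\<close>
    finally have "?s * (?s * (?a * turn j ^ m)) \<approx> 0"
      by (rule eqv_mult_zero_left)
    then show ?thesis
      by (cases "even m"; cases b) simp_all
  qed
  then show ?thesis by simp
qed

text \<open>Every row of the table is a computation modulo the relations: turns are moved past the
  new generator, which is then absorbed into the core.\<close>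

lemma nf_step:
  fixes s :: state
  assumes "valid n s"
  shows "nf n s * gen_word [g] \<approx>
    (case step n g s of None \<Rightarrow> 0 | Some (c, t) \<Rightarrow> of_int c * (nf n t :: gen word \<Rightarrow>\<^sub>0 'k::field))"
proof -
  obtain i j m b where s: "s = (i, j, m, b)" by (cases s)
  have ij: "i \<in> {1..n}" "j \<in> {1..n}" "m < i" "m < j"
    using assms by (auto simp: s)
  let ?N = "nf n s :: gen word \<Rightarrow>\<^sub>0 'k"
  have N: "?N * vert j \<approx> ?N"
    using nf_vert [OF ij(1,2)] by (simp only: s)
  \<comment> \<open>A generator that starts at a vertex different from \<open>j\<close> is killed by
    the orthogonality of the idempotents.\<close>
  have other: "?N * a \<approx> 0" if "k \<in> {1..n}" "k \<noteq> j" "vert k * a \<approx> a" for k and a :: "gen word \<Rightarrow>\<^sub>0 'k"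
  proof -
    have "?N * a \<approx> (?N * vert j) * (vert k * a)"
      by (intro eqv_mult eqv_sym [OF N] eqv_sym [OF that(3)])
    also have "\<dots> = ?N * (vert j * vert k) * a"
      by (simp add: mult.assoc)
    also have "\<dots> \<approx> 0"
      using that ij by (intro eqv_mult_zero_right [where c = a] eqv_mult_zero_left [where c = ?N] vert_orth) auto
    finally show ?thesis .
  qed
  show ?thesis
  proof (cases "g \<in> gens n")
    case False
    then have "step n g s = None"
      using ij by (cases g) (auto simp: s gens_def arrows_def Let_def)
    with eqv_mult_zero_left [OF eqv_not_gen [OF False]] show ?thesis
      by simp
  next
    case True
    then consider (vertex) l where "g = Vertex l" "l \<in> {1..n}"
      | (up) k where "g = Arrow k (Suc k)" "k \<in> {1..<n}"
      | (down) k where "g = Arrow (Suc k) k" "k \<in> {1..<n}"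
      | (loop) "g = Loop"
      by (auto simp: gens_def arrows_def)
    then show ?thesis
    proof cases
      case vertex
      then show ?thesis
        using N other [OF vertex(2) _ vert_idem [OF vertex(2)]]
        by (auto simp: s vert_def)
    next
      case up
      show ?thesis
      proof (cases "k = j")
        case False
        then show ?thesis
          using other [of k "gen_word [Arrow k (Suc k)]"] vert_arrow(1) [of k "Suc k"] up
          by (auto simp: s arrows_def Let_def)
      next
        case True
        let ?d = "if j < (if b then n else i) then 1 else 0 :: nat"
        have "core n i j b * (turn j ^ m * up j) \<approx>
            core n i j b * (up j * turn (Suc j) ^ m :: gen word \<Rightarrow>\<^sub>0 'k)"
          using up True by (intro eqv_mult_left turn_up) simp
        also have "\<dots> = core n i j b * up j * turn (Suc j) ^ m"
          by (simp add: mult.assoc)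
        also have "\<dots> = core n i (Suc j) b * turn (Suc j) ^ ?d * turn (Suc j) ^ m"
          using up True by (subst core_up) auto
        also have "\<dots> = nf n (i, Suc j, m + ?d, b)"
          by (simp add: mult.assoc power_add power_commutes)
        finally have "(- 1) ^ j * (core n i j b * (turn j ^ m * up j)) \<approx>
            (- 1) ^ j * (nf n (i, Suc j, m + ?d, b) :: gen word \<Rightarrow>\<^sub>0 'k)"
          by (rule eqv_mult_left)
        also have "(- 1) ^ j * (core n i j b * (turn j ^ m * up j)) = ?N * gen_word [g]"
          by (cases "even j") (simp_all add: up True s up_sign mult.assoc)
        finally have *: "?N * gen_word [g] \<approx> (- 1) ^ j * nf n (i, Suc j, m + ?d, b)" .
        show ?thesis
        \<comment> \<open>An invalid target is the case where \<open>step\<close> returns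
          \<open>None\<close>, and its normal form is congruent to 0.\<close>
        proof (cases "valid n (i, Suc j, m + ?d, b)")
          case True
          with * \<open>k = j\<close> up show ?thesis by (auto simp: s Let_def)
        next
          case False
          then have "nf n (i, Suc j, m + ?d, b) \<approx> (0 :: gen word \<Rightarrow>\<^sub>0 'k)"
            by (intro nf_zero) (use ij up True in simp_all)
          then have "?N * gen_word [g] \<approx> 0"
            using * eqv_mult_zero_left eqv_trans by blast
          with False True up show ?thesis by (auto simp: s Let_def)
        qed
      qed
    next
      case down
      show ?thesis
      proof (cases "j = Suc k")
        case False
        then show ?thesis
          using other [of "Suc k" "gen_word [Arrow (Suc k) k]"] vert_arrow(1) [of "Suc k" k] down
          by (auto simp: s arrows_def Let_def)
      next
        case True
        let ?d = "if (if b then n else i) < Suc k then 1 else 0 :: nat"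
        have "?N * gen_word [g] = core n i (Suc k) b * (turn (Suc k) ^ m * down k)"
          by (simp add: down True s down_def mult.assoc)
        also have "\<dots> \<approx> core n i (Suc k) b * (down k * turn k ^ m)"
          using down by (intro eqv_mult_left turn_down)
        also have "\<dots> = (core n i (Suc k) b * down k) * turn k ^ m"
          by (simp add: mult.assoc)
        also have "\<dots> \<approx> (core n i k b * turn k ^ ?d) * turn k ^ m"
          using down ij by (intro eqv_mult_right core_down)
        also have "\<dots> = nf n (i, k, m + ?d, b)"
          by (simp add: mult.assoc power_add power_commutes)
        finally have *: "?N * gen_word [g] \<approx> nf n (i, k, m + ?d, b)" .
        show ?thesis
        proof (cases "valid n (i, k, m + ?d, b)")
          case True
          with * \<open>j = Suc k\<close> down show ?thesis by (auto simp: s Let_def)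
        next
          case False
          then have "nf n (i, k, m + ?d, b) \<approx> (0 :: gen word \<Rightarrow>\<^sub>0 'k)"
            by (intro nf_zero) (use ij down True in simp_all)
          then have "?N * gen_word [g] \<approx> 0"
            using * eqv_trans by blast
          with False True down show ?thesis by (auto simp: s Let_def)
        qed
      qed
    next
      case loop
      have n1: "n \<in> {1..n}" using n by simp
      show ?thesis
      proof (cases "j = n")
        case False
        then show ?thesis
          using other [OF n1 _ vert_loop(1)] loop by (auto simp: s loop_def)
      next
        case True
        have "?N * gen_word [g] = core n i n b * (turn n ^ m * loop)"
          by (simp add: loop loop_def True s mult.assoc)
        also have "\<dots> \<approx> core n i n b * ((- 1) ^ m * (loop * turn n ^ m))"
          by (intro eqv_mult_left turn_loop)
        also have "\<dots> = (- 1) ^ m * (core n i n b * loop) * turn n ^ m"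
          by (cases "even m") (simp_all add: mult.assoc)
        finally have *: "?N * gen_word [g] \<approx> (- 1) ^ m * (core n i n b * loop) * turn n ^ m" .
        show ?thesis
        proof (cases b)
          case True
          \<comment> \<open>A second loop meets the first one with only \<open>vert n\<close> in
            between, so the square of the loop appears.\<close>
          have "core n i n b * loop = straight i n * loop * (vert n * loop :: gen word \<Rightarrow>\<^sub>0 'k)"
            using True by (simp add: core_def mult.assoc)
          also have "\<dots> \<approx> straight i n * loop * loop"
            by (intro eqv_mult_left vert_loop)
          also have "\<dots> = straight i n * (loop * loop)"
            by (simp add: mult.assoc)
          also have "\<dots> \<approx> 0"
            by (intro eqv_mult_zero_left loop_square)
          finally have "(- 1) ^ m * (core n i n b * loop) * turn n ^ m \<approx> (0 :: gen word \<Rightarrow>\<^sub>0 'k)"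
            by (intro eqv_mult_zero_right [where c = "turn n ^ m"] eqv_mult_zero_left [where c = "(- 1) ^ m"])
          with * have "?N * gen_word [g] \<approx> 0"
            by (rule eqv_trans)
          then show ?thesis
            using True loop by (simp add: s)
        next
          case False
          have "core n i n b * loop = straight i n * (loop :: gen word \<Rightarrow>\<^sub>0 'k)"
            using False by (simp add: core_def)
          also have "\<dots> \<approx> straight i n * (loop * vert n)"
            by (intro eqv_mult_left eqv_sym [OF vert_loop(2)])
          also have "\<dots> = core n i n True"
            by (simp add: core_def mult.assoc)
          finally have "(- 1) ^ m * (core n i n b * loop) * turn n ^ m \<approx>
              (- 1) ^ m * (core n i n True :: gen word \<Rightarrow>\<^sub>0 'k) * turn n ^ m"
            by (intro eqv_mult_right eqv_mult_left)
          with * have "?N * gen_word [g] \<approx> (- 1) ^ m * core n i n True * turn n ^ m"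
            by (rule eqv_trans)
          then show ?thesis
            using False True loop by (simp add: s mult.assoc)
        qed
      qed
    qed
  qed
qed

text \<open>Iterating \<open>nf_step\<close> along the word is exactly the recursion of
  \<open>act_word\<close>, with normal forms in place of scalars.\<close>

lemma nf_word:
  assumes "valid n s"
  shows "nf n s * gen_word gs \<approx> act_word n gs (nf n :: _ \<Rightarrow> gen word \<Rightarrow>\<^sub>0 'k::field) s"
  using assms
proof (induction gs arbitrary: s)
  case Nil
  have "gen_word [] = (1 :: gen word \<Rightarrow>\<^sub>0 'k)"
    by (simp add: gen_word_def zero_word_def flip: single_one)
  then show ?case by simp
next
  case (Cons g gs)
  have "gen_word (g # gs) = gen_word [g] * (gen_word gs :: gen word \<Rightarrow>\<^sub>0 'k)"
    using gen_word_append [of "[g]" gs] by simp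
  then have "nf n s * gen_word (g # gs) = nf n s * gen_word [g] * (gen_word gs :: gen word \<Rightarrow>\<^sub>0 'k)"
    by (simp add: mult.assoc)
  also have "\<dots> \<approx>
      (case step n g s of None \<Rightarrow> 0 | Some (c, t) \<Rightarrow> of_int c * nf n t) * gen_word gs"
    by (intro eqv_mult_right nf_step Cons.prems)
  also have "\<dots> \<approx> act_word n (g # gs) (nf n) s"
  proof (cases "step n g s")
    case (Some ct)
    obtain c t where ct: "ct = (c, t)" by (cases ct)
    have "valid n t"
      using Some ct valid_step Cons.prems by blast
    then have "of_int c * (nf n t * gen_word gs) \<approx> of_int c * act_word n gs (nf n :: _ \<Rightarrow> gen word \<Rightarrow>\<^sub>0 'k) t"
      by (intro eqv_mult_left Cons.IH)
    then show ?thesis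
      by (simp add: Some ct mult.assoc)
  qed simp
  finally show ?case .
qed

text \<open>The state \<open>(i, i, 0, False)\<close> has the normal form \<open>vert i\<close>,
  hence it is the starting point for all paths from \<open>i\<close>.\<close>

lemma vert_word:
  assumes "i \<in> {1..n}"
  shows "vert i * gen_word gs \<approx> act_word n gs (nf n :: _ \<Rightarrow> gen word \<Rightarrow>\<^sub>0 'k::field) (i, i, 0, False)"
  using nf_word [of "(i, i, 0, False)" gs] assms by (simp add: core_def)

end

section \<open>Basis words\<close>

text \<open>Each row of \<open>step\<close> has at most one target, so a word acts on states as a
  partial function with signs.\<close>

fun run :: "nat \<Rightarrow> gen list \<Rightarrow> state \<Rightarrow> (int \<times> state) option" where
  "run n [] s = Some (1, s)"
| "run n (g # gs) s =
     (case step n g s of None \<Rightarrow> None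
      | Some (c, t) \<Rightarrow> (case run n gs t of None \<Rightarrow> None | Some (d, u) \<Rightarrow> Some (c * d, u)))"

text \<open>With the loop, the path from \<open>i\<close> to \<open>n\<close> and on to
  \<open>j\<close> has length \<open>vdist i n + vdist n j\<close>. For vertices up to
  \<open>n\<close> this equals \<open>vdist i j + 2 * vdist (max i j) n\<close>.\<close>

fun degrees :: "nat \<Rightarrow> state \<Rightarrow> nat \<times> nat" where
  "degrees n (i, j, m, b) =
     (vdist i j + 2 * m + (if b then 2 * vdist (max i j) n else 0), if b then 1 else 0)"

lemma act_word_run:
  "act_word n gs F s = (case run n gs s of None \<Rightarrow> 0 | Some (c, t) \<Rightarrow> of_int c * F t)"
  by (induction gs arbitrary: s) (auto split: option.splits simp: mult.assoc)

lemma run_append: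
  "run n (us @ vs) s =
     (case run n us s of None \<Rightarrow> None
      | Some (c, t) \<Rightarrow> (case run n vs t of None \<Rightarrow> None | Some (d, u) \<Rightarrow> Some (c * d, u)))"
  by (induction us arbitrary: s) (auto split: option.splits simp: mult.assoc)

text \<open>An arrow that retraces the straight part shortens it by one but adds a turn of length
  two, so the length still grows by one. The loop occurs only at \<open>j = n\<close>, where the
  extra term for it is 0.\<close>

lemma step_sound:
  assumes "step n g s = Some (c, t)" "valid n s"
  shows "c = 1 \<or> c = - 1" "fst t = fst s"
    "degrees n t = (fst (degrees n s) + path_length (Word [g]), snd (degrees n s) + x_degree (Word [g]))"
proof -
  obtain i j m b where s: "s = (i, j, m, b)" by (cases s)
  have sign: "(- 1 :: int) ^ k = 1 \<or> (- 1 :: int) ^ k = - 1" for k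
    by (cases "even k") simp_all
  show "c = 1 \<or> c = - 1" "fst t = fst s"
    using assms sign by (cases g; auto simp: s Let_def split: if_splits)+
  show "degrees n t = (fst (degrees n s) + path_length (Word [g]), snd (degrees n s) + x_degree (Word [g]))"
  proof (cases g)
    case (Vertex l)
    then show ?thesis using assms by (auto simp: s path_length_def x_degree_def split: if_splits)
  next
    case Loop
    then show ?thesis using assms
      by (auto simp: s path_length_def x_degree_def vdist_def max_def split: if_splits)
  next
    case (Arrow k l)
    then have t: "t = (i, l, m + (if j < (if b then n else i) \<and> l = j + 1
          \<or> (if b then n else i) < j \<and> j = l + 1 then 1 else 0), b)"
      and kl: "l = j + 1 \<or> j = l + 1" and "valid n t"
      using assms by (auto simp: s Let_def simp del: valid.simps split: if_splits)
    then have "l \<le> n" "j \<le> n" "i \<le> n"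
      using assms(2) by (auto simp: s)
    with kl show ?thesis
      using Arrow by (cases b) (auto simp: t s path_length_def x_degree_def vdist_def max_def)
  qed
qed

lemma run_sound:
  assumes "run n gs s = Some (c, t)" "valid n s"
  shows "valid n t \<and> (c = 1 \<or> c = - 1) \<and> fst t = fst s \<and>
    degrees n t = (fst (degrees n s) + path_length (Word gs), snd (degrees n s) + x_degree (Word gs))"
  using assms
proof (induction gs arbitrary: s c)
  case Nil
  then show ?case by (simp add: path_length_def x_degree_def del: valid.simps)
next
  case (Cons g gs)
  from Cons.prems(1) obtain c' u d where *: "step n g s = Some (c', u)" "run n gs u = Some (d, t)" "c = c' * d"
    by (auto split: option.splits)
  note u = step_sound [OF *(1) Cons.prems(2)]
  show ?case
    using Cons.IH [OF *(2) valid_step [OF *(1) Cons.prems(2)]] u *(3)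
    by (auto simp: path_length_def x_degree_def simp del: valid.simps)
qed

definition reach :: "nat \<Rightarrow> state \<Rightarrow> state \<Rightarrow> bool" where
  "reach n s t \<longleftrightarrow> (\<exists>gs c. set gs \<subseteq> gens n \<and> run n gs s = Some (c, t))"

lemma reach_refl: "reach n s s"
  unfolding reach_def by (rule exI [of _ "[]"]) simp

lemma reach_step:
  assumes "reach n s t" "g \<in> gens n" "step n g t = Some (c, u)"
  shows "reach n s u"
proof -
  from assms(1) obtain gs d where "set gs \<subseteq> gens n" "run n gs s = Some (d, t)"
    by (auto simp: reach_def)
  with assms(2,3) show ?thesis
    unfolding reach_def by (intro exI [of _ "gs @ [g]"]) (auto simp: run_append)
qed

text \<open>Here \<open>i'\<close> is the start of the last straight part. Moving away from it never
  creates a turn.\<close>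

lemma reach_straight:
  assumes "reach n s (i, i', 0, b)" "i' = (if b then n else i)" "i \<in> {1..n}" "j \<in> {1..n}"
  shows "reach n s (i, j, 0, b)"
proof (cases i' j rule: le_cases)
  case le
  then show ?thesis using assms(4)
  proof (induction j rule: dec_induct)
    case base
    then show ?case using assms by simp
  next
    case (step j)
    show ?case
      by (rule reach_step [of n s "(i, j, 0, b)" "Arrow j (Suc j)" "(- 1) ^ j"])
        (use step assms(2,3) in \<open>auto simp: gens_def arrows_def Let_def split: if_splits\<close>)
  qed
next
  case ge
  then show ?thesis using assms(4)
  proof (induction j rule: inc_induct)
    case base
    then show ?case using assms by simp
  next
    case (step j)
    show ?case
      by (rule reach_step [of n s "(i, Suc j, 0, b)" "Arrow (Suc j) j" 1])
        (use step assms(2,3) in \<open>auto simp: gens_def arrows_def Let_def split: if_splits\<close>)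
  qed
qed

lemma reach_turns:
  assumes "reach n s (i, j, 0, b)" "valid n (i, j, m, b)"
  shows "reach n s (i, j, m, b)"
  using assms(2)
proof (induction m)
  case (Suc m)
  then obtain k where k: "j = Suc k" "k > 0" "Suc m < i" "m < k" "i \<le> n" "k < n"
    by (cases j) auto
  have m: "reach n s (i, j, m, b)"
    using Suc by simp
  \<comment> \<open>The new turn is counted on the way down if \<open>j\<close> lies above the start
    of the last straight part, and on the way up otherwise.\<close>
  define d where "d = (if (if b then n else i) < j then 1 else 0 :: nat)"
  have "reach n s (i, k, m + d, b)"
    by (rule reach_step [OF m, of "Arrow j k" 1])
      (use k in \<open>auto simp: gens_def arrows_def Let_def d_def\<close>)
  then show ?case
    by (rule reach_step [of n s "(i, k, m + d, b)" "Arrow k j" "(- 1) ^ k"])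
      (use k in \<open>auto simp: gens_def arrows_def Let_def d_def\<close>)
qed (use assms in simp)

lemma reach_valid:
  assumes "valid n (i, j, m, b)"
  shows "reach n (i, i, 0, False) (i, j, m, b)"
proof -
  have i: "i \<in> {1..n}" and j: "j \<in> {1..n}"
    using assms by auto
  have "reach n (i, i, 0, False) (i, n, 0, False)"
    using i by (intro reach_straight [OF reach_refl]) auto
  then have "reach n (i, i, 0, False) (i, n, 0, True)"
    by (rule reach_step [where g = Loop]) (auto simp: gens_def)
  then have "reach n (i, i, 0, False) (i, j, 0, b)"
    using reach_straight [OF reach_refl, where b = False] reach_straight [where b = True] i j
    by (cases b) auto
  then show ?thesis
    using assms by (rule reach_turns)
qed

text \<open>The vertex letters at both ends place the class of the word in the corner. A single
  word, unlike a combination of words, has an evident bidegree.\<close>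

definition basis_word :: "nat \<Rightarrow> state \<Rightarrow> gen list" where
  "basis_word n s = (SOME gs. set gs \<subseteq> gens n \<and> (\<exists>us c. gs = Vertex (fst s) # us @ [Vertex (fst (snd s))] \<and>
     run n gs (fst s, fst s, 0, False) = Some (c, s)))"

lemma basis_word:
  assumes "valid n (i, j, m, b)"
  obtains c us where "c = 1 \<or> c = - 1" "set (basis_word n (i, j, m, b)) \<subseteq> gens n"
    "basis_word n (i, j, m, b) = Vertex i # us @ [Vertex j]"
    "run n (basis_word n (i, j, m, b)) (i, i, 0, False) = Some (c, (i, j, m, b))"
proof -
  let ?P = "\<lambda>gs. set gs \<subseteq> gens n \<and> (\<exists>us c. gs = Vertex i # us @ [Vertex j] \<and>
     run n gs (i, i, 0, False) = Some (c, (i, j, m, b)))"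
  obtain us c where "set us \<subseteq> gens n" "run n us (i, i, 0, False) = Some (c, (i, j, m, b))"
    using reach_valid [OF assms] by (auto simp: reach_def)
  moreover have "Vertex i \<in> gens n" "Vertex j \<in> gens n"
    using assms by (auto simp: gens_def)
  ultimately have "?P (Vertex i # us @ [Vertex j])"
    by (auto simp: run_append)
  then have "?P (basis_word n (i, j, m, b))"
    unfolding basis_word_def fst_conv snd_conv by (rule someI)
  then obtain us c where P: "set (basis_word n (i, j, m, b)) \<subseteq> gens n"
    "basis_word n (i, j, m, b) = Vertex i # us @ [Vertex j]"
    "run n (basis_word n (i, j, m, b)) (i, i, 0, False) = Some (c, (i, j, m, b))"
    by (elim conjE exE)
  have "valid n (i, i, 0, False)"
    using assms by auto
  with run_sound [OF P(3)] have "c = 1 \<or> c = - 1"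
    by simp
  with P show ?thesis
    using that by simp
qed

section \<open>The quotient\<close>

context linear_quiver
begin

lemma cls_hom: "ring_hom_ring (free_algebra (gens n)) (Pi_C TYPE('k::field) n) (cls n)"
proof -
  have "cls n = (+>\<^bsub>free_algebra (gens n)\<^esub>) (rel_ideal TYPE('k) n)"
    by (rule ext) (simp add: cls_def)
  then show ?thesis
    using ideal.rcos_ring_hom_ring [OF ideal_rel_ideal] by (simp add: Pi_C_def)
qed

lemma carrier_Pi_C: "carrier (Pi_C TYPE('k::field) n) = cls n ` carrier (free_algebra (gens n))"
  by (auto simp: Pi_C_def FactRing_def A_RCOSETS_def' cls_def)

lemma cls_closed [simp]:
  fixes f :: "gen word \<Rightarrow>\<^sub>0 'k::field"
  shows "f \<in> carrier (free_algebra (gens n)) \<Longrightarrow> cls n f \<in> carrier (Pi_C TYPE('k) n)"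
  by (simp add: carrier_Pi_C)

lemma cls_add:
  fixes f g :: "gen word \<Rightarrow>\<^sub>0 'k::field"
  assumes "f \<in> carrier (free_algebra (gens n))" "g \<in> carrier (free_algebra (gens n))"
  shows "cls n (f + g) = cls n f \<oplus>\<^bsub>Pi_C TYPE('k) n\<^esub> cls n g"
  using ring_hom_add [OF ring_hom_ring.homh [OF cls_hom] assms] by simp

lemma cls_mult:
  fixes f g :: "gen word \<Rightarrow>\<^sub>0 'k::field"
  assumes "f \<in> carrier (free_algebra (gens n))" "g \<in> carrier (free_algebra (gens n))"
  shows "cls n (f * g) = cls n f \<otimes>\<^bsub>Pi_C TYPE('k) n\<^esub> cls n g"
  using ring_hom_mult [OF ring_hom_ring.homh [OF cls_hom] assms] by simp

lemma cls_zero: "cls n (0 :: gen word \<Rightarrow>\<^sub>0 'k::field) = \<zero>\<^bsub>Pi_C TYPE('k) n\<^esub>"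
  using ring_hom_zero [OF ring_hom_ring.homh [OF cls_hom] ring_free_algebra ring_Pi_C [OF n]] by simp

lemma cls_one: "cls n (1 :: gen word \<Rightarrow>\<^sub>0 'k::field) = \<one>\<^bsub>Pi_C TYPE('k) n\<^esub>"
  using ring_hom_one [OF ring_hom_ring.homh [OF cls_hom [where 'k = 'k]]] by simp

lemma free_algebra_diff:
  fixes f g :: "gen word \<Rightarrow>\<^sub>0 'k::field"
  assumes "f \<in> carrier (free_algebra G)" "g \<in> carrier (free_algebra G)"
  shows "f - g \<in> carrier (free_algebra G)"
  using assms keys_diff [of f g] by (auto simp: free_algebra_def)

lemma cls_eq_iff:
  fixes f g :: "gen word \<Rightarrow>\<^sub>0 'k::field"
  assumes "f \<in> carrier (free_algebra (gens n))" "g \<in> carrier (free_algebra (gens n))"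
  shows "cls n f = cls n g \<longleftrightarrow> f - g \<in> rel_ideal TYPE('k) n"
proof -
  interpret ring_hom_ring "free_algebra (gens n) :: (gen word \<Rightarrow>\<^sub>0 'k) ring" "Pi_C TYPE('k) n" "cls n"
    by (rule cls_hom)
  let ?A = "free_algebra (gens n) :: (gen word \<Rightarrow>\<^sub>0 'k) ring"
  have fg: "f - g \<in> carrier ?A"
    using assms by (rule free_algebra_diff)
  have "cls n f = cls n (f - g) \<oplus>\<^bsub>Pi_C TYPE('k) n\<^esub> cls n g"
    using cls_add [OF fg assms(2)] by simp
  then have "cls n f = cls n g \<longleftrightarrow> cls n (f - g) = \<zero>\<^bsub>Pi_C TYPE('k) n\<^esub>"
    using S.add.r_cancel_one' [of "cls n g" "cls n (f - g)"] fg assms by auto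
  also have "\<zero>\<^bsub>Pi_C TYPE('k) n\<^esub> = rel_ideal TYPE('k) n"
    by (simp add: Pi_C_def FactRing_def)
  also have "cls n (f - g) = rel_ideal TYPE('k) n \<longleftrightarrow> f - g \<in> rel_ideal TYPE('k) n"
    using R.a_rcos_zero [OF ideal_rel_ideal] fg
      abelian_subgroup.a_rcos_self [OF abelian_subgroupI3 [OF ideal.axioms(1) [OF ideal_rel_ideal]
        R.abelian_group_axioms] fg]
    unfolding cls_def by auto
  finally show ?thesis .
qed

lemma cls_eqI:
  fixes f g :: "gen word \<Rightarrow>\<^sub>0 'k::field"
  assumes "f \<approx> g" "f \<in> carrier (free_algebra (gens n))" "g \<in> carrier (free_algebra (gens n))"
  shows "cls n f = cls n g"
  using assms free_algebra_diff [OF assms(2,3)] by (simp add: cls_eq_iff eqv_def restrict_gens_id)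

lemma act_cls_eq:
  fixes f g :: "gen word \<Rightarrow>\<^sub>0 'k::field"
  assumes "cls n f = cls n g" "f \<in> carrier (free_algebra (gens n))" "g \<in> carrier (free_algebra (gens n))"
    and "valid n s"
  shows "act n f F s = act n g F s"
proof -
  have "f - g \<in> rel_ideal TYPE('k) n"
    using assms cls_eq_iff by blast
  from act_rel_ideal [OF n this assms(4)] show ?thesis
    by (simp add: act_diff)
qed

lemma gen_word_closed: "set gs \<subseteq> G \<Longrightarrow> gen_word gs \<in> carrier (free_algebra G)"
  by (simp add: gen_word_def free_algebra_def)

lemma scalar_closed: "Poly_Mapping.single 0 c \<in> carrier (free_algebra G)"
  by (auto simp: free_algebra_def zero_word_def)

lemma subfield_scalars: "subfield (scalars TYPE('k::field) n) (Pi_C TYPE('k) n)"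
proof -
  \<comment> \<open>The ground field as a ring structure with a carrier, so that the scalars become
    the image of a field under a ring homomorphism.\<close>
  define F :: "'k ring" where
    "F = \<lparr>carrier = UNIV, monoid.mult = (*), one = 1, zero = 0, add = (+)\<rparr>"
  interpret P: ring "Pi_C TYPE('k) n" by (rule ring_Pi_C [OF n])
  have "field F"
  proof (rule cring.cring_fieldI)
    show "cring F"
    proof (rule cringI)
      show "abelian_group F"
        by (rule abelian_groupI) (auto simp: F_def add_ac intro: exI [of _ "- _"] ab_left_minus)
    next
      show "comm_monoid F"
        by (rule comm_monoidI) (auto simp: F_def mult_ac)
    qed (simp add: F_def distrib_right)
    show "Units F = carrier F - {\<zero>\<^bsub>F\<^esub>}"
      by (auto simp: F_def Units_def intro: exI [of _ "inverse _"])
        (metis left_inverse right_inverse)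
  qed
  then interpret F: field F .
  have hom: "ring_hom_ring F (Pi_C TYPE('k) n) (\<lambda>c. cls n (Poly_Mapping.single 0 c))"
  proof (rule ring_hom_ringI2 [OF F.ring_axioms P.ring_axioms], rule ring_hom_memI)
    fix x y assume "x \<in> carrier F" "y \<in> carrier F"
    show "cls n (Poly_Mapping.single 0 x) \<in> carrier (Pi_C TYPE('k) n)"
      by (simp add: scalar_closed)
    show "cls n (Poly_Mapping.single 0 (x \<otimes>\<^bsub>F\<^esub> y)) =
        cls n (Poly_Mapping.single 0 x) \<otimes>\<^bsub>Pi_C TYPE('k) n\<^esub> cls n (Poly_Mapping.single 0 y)"
      by (simp add: F_def scalar_closed mult_single flip: cls_mult)
    show "cls n (Poly_Mapping.single 0 (x \<oplus>\<^bsub>F\<^esub> y)) =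
        cls n (Poly_Mapping.single 0 x) \<oplus>\<^bsub>Pi_C TYPE('k) n\<^esub> cls n (Poly_Mapping.single 0 y)"
      by (simp add: F_def scalar_closed single_add flip: cls_add)
  next
    show "cls n (Poly_Mapping.single 0 \<one>\<^bsub>F\<^esub>) = \<one>\<^bsub>Pi_C TYPE('k) n\<^esub>"
      by (simp add: F_def cls_one)
  qed
  have "\<one>\<^bsub>Pi_C TYPE('k) n\<^esub> \<noteq> \<zero>\<^bsub>Pi_C TYPE('k) n\<^esub>"
  proof
    assume "\<one>\<^bsub>Pi_C TYPE('k) n\<^esub> = \<zero>\<^bsub>Pi_C TYPE('k) n\<^esub>"
    then have "cls n (1 :: gen word \<Rightarrow>\<^sub>0 'k) = cls n 0"
      by (simp add: cls_one cls_zero)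
    \<comment> \<open>The quotient is nonzero because the module is: on a valid state, 1 acts as the
      identity and 0 as zero.\<close>
    then have "act n (1 :: gen word \<Rightarrow>\<^sub>0 'k) (\<lambda>_. 1) (1, 1, 0, False) = act n 0 (\<lambda>_. 1) (1, 1, 0, False)"
      by (rule act_cls_eq)
        (use n scalar_closed [of 1] scalar_closed [of 0] in simp_all)
    then show False by simp
  qed
  from ring_hom_ring.img_is_subfield(2) [OF hom F.carrier_is_subfield this] show ?thesis
    by (simp add: scalars_def F_def)
qed

end

section \<open>Bases of the corners\<close>

lemma single_zero_commute:
  fixes f :: "'g word \<Rightarrow>\<^sub>0 'k::field"
  shows "Poly_Mapping.single 0 c * f = f * Poly_Mapping.single 0 c"
  by (induction f rule: poly_mapping_additive_induct)
    (simp_all add: mult_single mult.commute distrib_left distrib_right)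

text \<open>\<open>Span\<close> grows by one line at a time, so it is enough to follow the addition
  of a multiple of one listed vector.\<close>

lemma (in ring) Span_subset:
  assumes "\<zero> \<in> E" "\<And>k u v. k \<in> K \<Longrightarrow> u \<in> set Us \<Longrightarrow> v \<in> E \<Longrightarrow> k \<otimes> u \<oplus> v \<in> E"
  shows "Span K Us \<subseteq> E"
  using assms by (induction Us) (auto simp: line_extension_mem_iff, blast)

lemma free_algebra_add:
  "f \<in> carrier (free_algebra G) \<Longrightarrow> g \<in> carrier (free_algebra G) \<Longrightarrow> f + g \<in> carrier (free_algebra G)"
  using ring.ring_simprules(1) [OF ring_free_algebra] by fastforce

lemma free_algebra_mult:
  "f \<in> carrier (free_algebra G) \<Longrightarrow> g \<in> carrier (free_algebra G) \<Longrightarrow> f * g \<in> carrier (free_algebra G)"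
  using ring.ring_simprules(5) [OF ring_free_algebra] by fastforce

definition states :: "nat \<Rightarrow> nat \<Rightarrow> state list" where
  "states i j = map (\<lambda>m. (i, j, m, False)) [0..<min i j] @ map (\<lambda>m. (i, j, m, True)) [0..<min i j]"

lemma set_states: "set (states i j) = {(i, j, m, b) | m b. m < min i j}"
proof (intro equalityI subsetI)
  fix s :: state
  assume "s \<in> {(i, j, m, b) | m b. m < min i j}"
  then obtain m b where "s = (i, j, m, b)" "m < min i j"
    by blast
  then show "s \<in> set (states i j)"
    by (cases b) (auto simp: states_def)
qed (auto simp: states_def)

lemma distinct_states: "distinct (states i j)"
  by (auto simp: states_def distinct_map inj_on_def)

lemma length_states: "length (states i j) = 2 * min i j"
  by (simp add: states_def)

context linear_quiver
begin

lemma vert_closed: "i \<in> {1..n} \<Longrightarrow> vert i \<in> carrier (free_algebra (gens n))"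
  unfolding vert_def by (rule gen_word_closed) (simp add: gens_def)

lemma basis_word_reduced:
  assumes "valid n (i, j, m, b)"
  shows "vert i * gen_word (basis_word n (i, j, m, b)) * vert j \<approx> gen_word (basis_word n (i, j, m, b))"
proof -
  have ij: "i \<in> {1..n}" "j \<in> {1..n}" using assms by auto
  obtain us where us: "basis_word n (i, j, m, b) = Vertex i # us @ [Vertex j]"
    using basis_word [OF assms] by metis
  have *: "gen_word (basis_word n (i, j, m, b)) = vert i * gen_word us * vert j"
    by (simp add: us vert_def flip: gen_word_append)
  have "vert i * (vert i * gen_word us * vert j) * vert j =
      (vert i * vert i) * gen_word us * (vert j * vert j)"
    by (simp add: mult.assoc)
  also have "\<dots> \<approx> vert i * gen_word us * vert j"
    by (intro eqv_mult eqv_refl vert_idem ij)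
  finally show ?thesis
    by (simp only: *)
qed

lemma basis_word_degrees:
  assumes "valid n (i, j, m, b)"
  shows "(path_length (Word (basis_word n (i, j, m, b))), x_degree (Word (basis_word n (i, j, m, b))))
    = degrees n (i, j, m, b)"
proof -
  obtain c where c: "run n (basis_word n (i, j, m, b)) (i, i, 0, False) = Some (c, (i, j, m, b))"
    using basis_word [OF assms] by metis
  have "valid n (i, i, 0, False)" using assms by auto
  from run_sound [OF c this] show ?thesis
    by (simp add: vdist_def)
qed

text \<open>The run of the word, closed by the letter \<open>Vertex j\<close>, either breaks off or
  ends in a state at \<open>j\<close>. In the second case the word and the basis word of that state
  are both congruent to the same normal form up to sign. Vertices have degree zero, so the end state
  has the bidegree of the word.\<close>

lemma word_cases:
  assumes "i \<in> {1..n}" "j \<in> {1..n}"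
  obtains "vert i * gen_word gs * vert j \<approx> (0 :: gen word \<Rightarrow>\<^sub>0 'k::field)"
  | c m b where "valid n (i, j, m, b)"
      "degrees n (i, j, m, b) = (path_length (Word gs), x_degree (Word gs))"
      "vert i * gen_word gs * vert j \<approx>
         of_int c * (gen_word (basis_word n (i, j, m, b)) :: gen word \<Rightarrow>\<^sub>0 'k::field)"
proof -
  let ?s = "(i, i, 0, False)" and ?gs = "gs @ [Vertex j]"
  have s: "valid n ?s" using assms by auto
  have w: "vert i * gen_word gs * vert j = vert i * (gen_word ?gs :: gen word \<Rightarrow>\<^sub>0 'k)"
    by (simp add: gen_word_append vert_def mult.assoc)
  note act = vert_word [OF assms(1), of ?gs, where 'k = 'k, unfolded act_word_run]
  show ?thesis
  proof (cases "run n ?gs ?s")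
    case None
    with act w that(1) show ?thesis by simp
  next
    case (Some ct)
    obtain c t where ct: "ct = (c, t)" by (cases ct)
    note r = run_sound [OF Some [unfolded ct] s]
    obtain m b where t: "t = (i, j, m, b)"
      using r Some ct by (cases t) (auto simp: run_append split: option.splits if_splits)
    then have v: "valid n (i, j, m, b)" using r by blast
    obtain d us where d: "d = 1 \<or> d = - 1"
      "basis_word n (i, j, m, b) = Vertex i # us @ [Vertex j]"
      "run n (basis_word n (i, j, m, b)) ?s = Some (d, (i, j, m, b))"
      using basis_word [OF v] by metis
    \<comment> \<open>The first letter of the basis word is split off: it plays the part of
      \<open>vert i\<close> in \<open>vert_word\<close> and fixes the starting state.\<close>
    have "vert i * gen_word (us @ [Vertex j]) \<approx> of_int d * (nf n t :: gen word \<Rightarrow>\<^sub>0 'k)"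
      using vert_word [OF assms(1), of "us @ [Vertex j]", where 'k = 'k] d
      by (simp add: act_word_run t split: option.splits)
    also have "vert i * gen_word (us @ [Vertex j]) = gen_word (basis_word n (i, j, m, b))"
      by (simp add: d(2) vert_def flip: gen_word_append)
    finally have "of_int d * gen_word (basis_word n (i, j, m, b)) \<approx>
        of_int d * (of_int d * (nf n t :: gen word \<Rightarrow>\<^sub>0 'k))"
      by (rule eqv_mult_left)
    also have "of_int d * (of_int d * (nf n t :: gen word \<Rightarrow>\<^sub>0 'k)) = nf n t"
      using d(1) by auto
    finally have nf: "nf n t \<approx> of_int d * (gen_word (basis_word n (i, j, m, b)) :: gen word \<Rightarrow>\<^sub>0 'k)"
      by (rule eqv_sym)
    have "vert i * gen_word gs * vert j \<approx> of_int c * (nf n t :: gen word \<Rightarrow>\<^sub>0 'k)"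
      using act Some ct w by simp
    also have "\<dots> \<approx> of_int c * (of_int d * gen_word (basis_word n (i, j, m, b)))"
      by (intro eqv_mult_left nf)
    also have "\<dots> = of_int (c * d) * gen_word (basis_word n (i, j, m, b))"
      by (simp add: mult.assoc)
    finally have "vert i * gen_word gs * vert j \<approx>
        of_int (c * d) * (gen_word (basis_word n (i, j, m, b)) :: gen word \<Rightarrow>\<^sub>0 'k)" .
    moreover have "degrees n (i, j, m, b) = (path_length (Word gs), x_degree (Word gs))"
      using r by (simp add: t path_length_def x_degree_def vdist_def)
    ultimately show ?thesis
      using that(2) v by blast
  qed
qed

section \<open>Spanning of the corners and of their bigraded pieces\<close>

definition basis_elt :: "state \<Rightarrow> (gen word \<Rightarrow>\<^sub>0 'k::field) set" where
  "basis_elt s = cls n (gen_word (basis_word n s))"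

lemma basis_word_closed:
  "valid n s \<Longrightarrow> gen_word (basis_word n s) \<in> carrier (free_algebra (gens n))"
  by (cases s) (metis basis_word gen_word_closed)

lemma basis_elt_closed:
  "valid n s \<Longrightarrow> basis_elt s \<in> carrier (Pi_C TYPE('k::field) n)"
  unfolding basis_elt_def by (intro cls_closed basis_word_closed)

text \<open>Multiplication by the idempotents on both sides is a projection, so its image is the set
  of its fixed elements. This gives a condition on a representative.\<close>

lemma corner_eq:
  assumes "i \<in> {1..n}" "j \<in> {1..n}"
  shows "corner TYPE('k::field) n i j =
    {cls n f | f. f \<in> carrier (free_algebra (gens n)) \<and> vert i * f * vert j \<approx> f}"
proof -
  note closed = free_algebra_mult vert_closed [OF assms(1)] vert_closed [OF assms(2)]
  show ?thesis
  proof (intro equalityI subsetI)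
    fix y assume "y \<in> corner TYPE('k) n i j"
    then obtain f :: "gen word \<Rightarrow>\<^sub>0 'k" where f: "f \<in> carrier (free_algebra (gens n))"
      and "y = cls n (vert i) \<otimes>\<^bsub>Pi_C TYPE('k) n\<^esub> cls n f \<otimes>\<^bsub>Pi_C TYPE('k) n\<^esub> cls n (vert j)"
      by (auto simp: corner_def carrier_Pi_C vert_def)
    then have y: "y = cls n (vert i * f * vert j)"
      by (simp add: cls_mult closed)
    have "vert i * (vert i * f * vert j) * vert j = (vert i * vert i) * f * (vert j * vert j)"
      by (simp add: mult.assoc)
    also have "\<dots> \<approx> vert i * f * vert j"
      by (intro eqv_mult eqv_refl vert_idem assms)
    finally show "y \<in> {cls n f | f. f \<in> carrier (free_algebra (gens n)) \<and> vert i * f * vert j \<approx> f}"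
      using y f by (auto intro!: exI [of _ "vert i * f * vert j"] closed)
  next
    fix y :: "(gen word \<Rightarrow>\<^sub>0 'k) set"
    assume "y \<in> {cls n f | f. f \<in> carrier (free_algebra (gens n)) \<and> vert i * f * vert j \<approx> f}"
    then obtain f where f: "f \<in> carrier (free_algebra (gens n))" "vert i * f * vert j \<approx> f" "y = cls n f"
      by blast
    then have "y = cls n (vert i * f * vert j)"
      using cls_eqI [OF f(2)] by (simp add: closed)
    then show "y \<in> corner TYPE('k) n i j"
      unfolding corner_def vert_def [symmetric] using f(1)
      by (auto simp: cls_mult closed intro!: exI [of _ "cls n f"])
  qed
qed

lemma cls_scale_basis:
  fixes c :: "'k::field"
  assumes "valid n s"
  shows "cls n (Poly_Mapping.single 0 c * gen_word (basis_word n s)) =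
    cls n (Poly_Mapping.single 0 c) \<otimes>\<^bsub>Pi_C TYPE('k) n\<^esub> basis_elt s"
  by (simp add: cls_mult scalar_closed basis_word_closed assms basis_elt_def)

text \<open>The predicate \<open>P\<close> treats the whole corner and its bigraded pieces at once.
  An element of the intersection comes with two representatives, one fixed by the idempotents modulo
  the ideal and one supported on words of the right degrees; they need not coincide.\<close>

lemma corner_part:
  assumes ij: "i \<in> {1..n}" "j \<in> {1..n}"
  shows "corner TYPE('k::field) n i j \<inter>
      cls n ` {f \<in> carrier (free_algebra (gens n)). \<forall>w\<in>Poly_Mapping.keys f. P (path_length w, x_degree w)} =
    ring.Span (Pi_C TYPE('k) n) (scalars TYPE('k) n)
      (map basis_elt (filter (P \<circ> degrees n) (states i j)))" (is "?L = ?R")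
proof -
  interpret Pi: ring "Pi_C TYPE('k) n" by (rule ring_Pi_C [OF n])
  let ?A = "free_algebra (gens n) :: (gen word \<Rightarrow>\<^sub>0 'k) ring"
  let ?Us = "map basis_elt (filter (P \<circ> degrees n) (states i j)) :: (gen word \<Rightarrow>\<^sub>0 'k) set list"
  note K = subfield_scalars [where 'k = 'k]
  have valid: "valid n s" if "s \<in> set (states i j)" for s
    using that ij by (auto simp: set_states)
  then have Us: "set ?Us \<subseteq> carrier (Pi_C TYPE('k) n)"
    using basis_elt_closed [where 'k = 'k] by (auto simp del: valid.simps)
  show ?thesis
  proof
    show "?R \<subseteq> ?L"
    proof (rule Pi.Span_subset)
      have "0 \<in> carrier ?A" using ring.ring_simprules(2) [OF ring_free_algebra] by fastforce
      then show "\<zero>\<^bsub>Pi_C TYPE('k) n\<^esub> \<in> ?L"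
        by (auto simp: corner_eq [OF ij] intro!: exI [of _ 0] image_eqI [of _ _ 0] simp flip: cls_zero)
    next
      fix k u v
      assume "k \<in> scalars TYPE('k) n" "u \<in> set ?Us" and v: "v \<in> ?L"
      then obtain c m b where k: "k = cls n (Poly_Mapping.single 0 c)"
        and u: "u = basis_elt (i, j, m, b)" "P (degrees n (i, j, m, b))"
        and val: "valid n (i, j, m, b)"
        using valid by (auto simp: scalars_def set_states simp del: degrees.simps valid.simps)
      from v obtain f g where f: "f \<in> carrier ?A" "vert i * f * vert j \<approx> f" "v = cls n f"
        and g: "g \<in> carrier ?A" "\<forall>w\<in>Poly_Mapping.keys g. P (path_length w, x_degree w)" "v = cls n g"
        by (auto simp: corner_eq [OF ij])
      let ?w = "basis_word n (i, j, m, b)"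
      let ?h = "Poly_Mapping.single 0 c * gen_word ?w"
      have h: "?h \<in> carrier ?A"
        by (intro free_algebra_mult scalar_closed basis_word_closed val)
      have "vert i * (?h + f) * vert j = Poly_Mapping.single 0 c * (vert i * gen_word ?w * vert j) + vert i * f * vert j"
        by (simp add: distrib_left distrib_right flip: mult.assoc single_zero_commute)
      also have "\<dots> \<approx> ?h + f"
        by (intro eqv_add eqv_mult_left basis_word_reduced val f)
      finally have hf: "vert i * (?h + f) * vert j \<approx> ?h + f" .
      have "?h = Poly_Mapping.single (Word ?w) c"
        by (simp add: gen_word_def mult_single)
      then have "Poly_Mapping.keys (?h + g) \<subseteq> insert (Word ?w) (Poly_Mapping.keys g)"
        using Poly_Mapping.keys_add [of ?h g] by (auto split: if_splits)
      then have hg: "\<forall>w\<in>Poly_Mapping.keys (?h + g). P (path_length w, x_degree w)"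
        using g(2) u(2) basis_word_degrees [OF val] by auto
      have eq: "k \<otimes>\<^bsub>Pi_C TYPE('k) n\<^esub> u \<oplus>\<^bsub>Pi_C TYPE('k) n\<^esub> v = cls n ?h \<oplus>\<^bsub>Pi_C TYPE('k) n\<^esub> v"
        by (simp add: k u cls_scale_basis [OF val])
      have "cls n ?h \<oplus>\<^bsub>Pi_C TYPE('k) n\<^esub> v \<in> corner TYPE('k) n i j"
        unfolding corner_eq [OF ij] using hf h f by (auto simp: cls_add free_algebra_add intro!: exI [of _ "?h + f"])
      moreover have "cls n ?h \<oplus>\<^bsub>Pi_C TYPE('k) n\<^esub> v \<in>
          cls n ` {f \<in> carrier ?A. \<forall>w\<in>Poly_Mapping.keys f. P (path_length w, x_degree w)}"
        using hg h g by (auto simp: cls_add free_algebra_add intro!: image_eqI [of _ _ "?h + g"])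
      ultimately show "k \<otimes>\<^bsub>Pi_C TYPE('k) n\<^esub> u \<oplus>\<^bsub>Pi_C TYPE('k) n\<^esub> v \<in> ?L"
        unfolding eq by blast
    qed
  next
    define R where "R = ?R"
    have R_zero: "\<zero>\<^bsub>Pi_C TYPE('k) n\<^esub> \<in> R"
      and R_add: "\<And>u v. u \<in> R \<Longrightarrow> v \<in> R \<Longrightarrow> u \<oplus>\<^bsub>Pi_C TYPE('k) n\<^esub> v \<in> R"
      and R_scale: "\<And>k v. k \<in> scalars TYPE('k) n \<Longrightarrow> v \<in> R \<Longrightarrow> k \<otimes>\<^bsub>Pi_C TYPE('k) n\<^esub> v \<in> R"
      and R_basis: "set ?Us \<subseteq> R"
      unfolding R_def
      by (fact Pi.Span_subgroup_props(2,3) [OF K Us] Pi.Span_smult_closed [OF K Us] Pi.Span_base_incl [OF K Us])+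
    show "?L \<subseteq> ?R"
      unfolding R_def [symmetric]
    proof
      fix y assume "y \<in> ?L"
      then obtain g f where g: "g \<in> carrier ?A" "\<forall>w\<in>Poly_Mapping.keys g. P (path_length w, x_degree w)" "y = cls n g"
        and f: "f \<in> carrier ?A" "vert i * f * vert j \<approx> f" "y = cls n f"
        by (auto simp: corner_eq [OF ij])
      \<comment> \<open>The representative \<open>f\<close> shows that the idempotents fix the
        class, after which \<open>f\<close> can be exchanged for \<open>g\<close>. Each word of
        \<open>g\<close> between the idempotents is then 0 or a signed basis word of the same
        bidegree.\<close>
      have "y = cls n (vert i * f * vert j)"
        using cls_eqI [OF f(2)] f by (simp add: free_algebra_mult vert_closed [OF ij(1)] vert_closed [OF ij(2)])
      also have "\<dots> = cls n (vert i * g * vert j)"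
        using f g by (simp add: cls_mult free_algebra_mult vert_closed [OF ij(1)] vert_closed [OF ij(2)])
      finally have y: "y = cls n (vert i * g * vert j)" .
      let ?t = "\<lambda>w. Poly_Mapping.single w (Poly_Mapping.lookup g w)"
      have t: "?t w \<in> carrier ?A" if "w \<in> Poly_Mapping.keys g" for w
        using g(1) that by (simp add: free_algebra_def)
      have partial: "(\<Sum>w\<in>B. ?t w) \<in> carrier ?A \<and> cls n (vert i * (\<Sum>w\<in>B. ?t w) * vert j) \<in> R"
        if "finite B" "B \<subseteq> Poly_Mapping.keys g" for B
        using that
      proof (induction B)
        case empty
        have "0 \<in> carrier ?A" using ring.ring_simprules(2) [OF ring_free_algebra] by fastforce
        then show ?case
          using R_zero by (simp add: cls_zero)
      next
        case (insert w B)
        then have w: "w \<in> Poly_Mapping.keys g" by simp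
        let ?c = "Poly_Mapping.lookup g w"
        let ?v = "vert i * ?t w * vert j"
        have closed: "?v \<in> carrier ?A"
          using t [OF w] by (intro free_algebra_mult vert_closed [OF ij(1)] vert_closed [OF ij(2)])
        have "?t w = Poly_Mapping.single 0 ?c * gen_word (letters w)"
          by (simp add: gen_word_def mult_single)
        then have v: "?v = Poly_Mapping.single 0 ?c * (vert i * gen_word (letters w) * vert j)"
          by (simp flip: mult.assoc single_zero_commute)
        have "cls n ?v \<in> R"
        proof (cases rule: word_cases [OF ij, of "letters w", where 'k = 'k])
          case 1
          then have "?v \<approx> 0"
            unfolding v by (rule eqv_mult_zero_left)
          then have "cls n ?v = cls n 0"
            using closed insert.IH insert.prems
            by (intro cls_eqI) (use ring.ring_simprules(2) [OF ring_free_algebra] in fastforce)+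
          then show ?thesis
            using R_zero by (simp add: cls_zero)
        next
          case (2 d m b)
          let ?s = "(i, j, m, b)"
          let ?d = "Poly_Mapping.single 0 (?c * of_int d) :: gen word \<Rightarrow>\<^sub>0 'k"
          have "?v \<approx> Poly_Mapping.single 0 ?c * (of_int d * gen_word (basis_word n ?s))"
            unfolding v by (intro eqv_mult_left 2)
          also have "\<dots> = ?d * gen_word (basis_word n ?s)"
            by (simp add: mult_single flip: mult.assoc single_of_int)
          finally have "cls n ?v = cls n ?d \<otimes>\<^bsub>Pi_C TYPE('k) n\<^esub> basis_elt ?s"
            unfolding cls_scale_basis [OF 2(1), symmetric]
            by (rule cls_eqI) (intro closed free_algebra_mult scalar_closed basis_word_closed 2)+
          moreover have "basis_elt ?s \<in> set ?Us"
            using 2(1,2) g(2) w by (auto simp: set_states simp del: degrees.simps)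
          then have "basis_elt ?s \<in> R"
            using R_basis by blast
          then have "cls n ?d \<otimes>\<^bsub>Pi_C TYPE('k) n\<^esub> basis_elt ?s \<in> R"
            by (intro R_scale) (auto simp: scalars_def)
          ultimately show ?thesis by (simp only:)
        qed
        moreover have "vert i * (\<Sum>w\<in>insert w B. ?t w) * vert j = ?v + vert i * (\<Sum>w\<in>B. ?t w) * vert j"
          using insert.hyps by (simp add: distrib_left distrib_right)
        moreover have "(\<Sum>w\<in>B. ?t w) \<in> carrier ?A" "cls n (vert i * (\<Sum>w\<in>B. ?t w) * vert j) \<in> R"
          using insert.IH insert.prems by simp_all
        ultimately show ?case
          using insert.hyps t [OF w] closed
          by (simp add: cls_add free_algebra_add free_algebra_mult vert_closed [OF ij(1)] vert_closed [OF ij(2)] R_add)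
      qed
      have "cls n (vert i * (\<Sum>w\<in>Poly_Mapping.keys g. ?t w) * vert j) \<in> R"
        by (rule conjunct2 [OF partial [OF finite_keys order_refl]])
      also have "(\<Sum>w\<in>Poly_Mapping.keys g. ?t w) = g"
        by (rule poly_mapping_eqI) (simp add: lookup_sum lookup_single when_def in_keys_iff)
      finally show "y \<in> R"
        by (simp only: y)
    qed
  qed
qed

text \<open>The indicator function of \<open>s\<close>, acted on by an element and evaluated at the
  starting state, reads off the coefficient of \<open>s\<close> up to sign. It vanishes on all later
  basis words but not on that of \<open>s\<close>.\<close>

lemma independent_basis:
  assumes "i \<in> {1..n}" "distinct ss" "\<forall>s\<in>set ss. valid n s \<and> fst s = i"
  shows "ring.independent (Pi_C TYPE('k::field) n) (scalars TYPE('k) n) (map basis_elt ss)"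
proof -
  interpret Pi: ring "Pi_C TYPE('k) n" by (rule ring_Pi_C [OF n])
  let ?A = "free_algebra (gens n) :: (gen word \<Rightarrow>\<^sub>0 'k) ring"
  show ?thesis
    using assms(2,3)
  proof (induction ss)
    case (Cons s ss)
    let ?F = "\<lambda>t. if t = s then 1 else 0 :: 'k"
    let ?\<phi> = "\<lambda>f. act n f ?F (i, i, 0, False)"
    have \<phi>: "\<exists>c. (c = 1 \<or> c = - 1) \<and> ?\<phi> (gen_word (basis_word n t)) = (if t = s then c else 0)"
      if "t \<in> set (s # ss)" for t
    proof -
      have "valid n t \<and> fst t = i"
        using Cons.prems(2) that by blast
      then obtain j m b where t: "t = (i, j, m, b)" "valid n (i, j, m, b)"
        by (metis prod.collapse)
      obtain c where "c = 1 \<or> c = - 1" "run n (basis_word n t) (i, i, 0, False) = Some (c, t)"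
        using basis_word [OF t(2)] unfolding t(1) by metis
      then show ?thesis
        by (intro exI [of _ "of_int c"]) (auto simp: act_word_run)
    qed
    \<comment> \<open>Membership in \<open>?E\<close> asks for one representative on which the
      functional vanishes. Independence of the representative is invoked only once, for the class of
      \<open>s\<close>.\<close>
    have "Pi.Span (scalars TYPE('k) n) (map basis_elt ss) \<subseteq> {cls n f | f. f \<in> carrier ?A \<and> ?\<phi> f = 0}"
      (is "_ \<subseteq> ?E")
    proof (rule Pi.Span_subset)
      have "0 \<in> carrier ?A" using ring.ring_simprules(2) [OF ring_free_algebra] by fastforce
      then show "\<zero>\<^bsub>Pi_C TYPE('k) n\<^esub> \<in> ?E"
        by (auto intro!: exI [of _ 0] simp flip: cls_zero)
    next
      fix k u v :: "(gen word \<Rightarrow>\<^sub>0 'k) set"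
      assume "k \<in> scalars TYPE('k) n" "u \<in> set (map basis_elt ss)" "v \<in> ?E"
      then obtain c t f where k: "k = cls n (Poly_Mapping.single 0 c)"
        and u: "u = basis_elt t" "t \<in> set ss" and v: "v = cls n f" "f \<in> carrier ?A" "?\<phi> f = 0"
        by (auto simp: scalars_def)
      let ?h = "Poly_Mapping.single 0 c * gen_word (basis_word n t)"
      have val: "valid n t" using Cons.prems u by auto
      then have h: "?h \<in> carrier ?A"
        by (intro free_algebra_mult scalar_closed basis_word_closed)
      have "?\<phi> (gen_word (basis_word n t)) = 0"
        using \<phi> [of t] u Cons.prems(1) by auto
      then have "?\<phi> (?h + f) = 0"
        by (simp add: act_add act_mult v zero_word_def)
      moreover have "k \<otimes>\<^bsub>Pi_C TYPE('k) n\<^esub> u \<oplus>\<^bsub>Pi_C TYPE('k) n\<^esub> v = cls n (?h + f)"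
        using h v by (simp add: k u cls_add cls_scale_basis [OF val])
      ultimately show "k \<otimes>\<^bsub>Pi_C TYPE('k) n\<^esub> u \<oplus>\<^bsub>Pi_C TYPE('k) n\<^esub> v \<in> ?E"
        using h v by (auto intro!: exI [of _ "?h + f"] free_algebra_add)
    qed
    moreover have "basis_elt s \<notin> ?E"
    proof
      assume "basis_elt s \<in> ?E"
      then obtain f where f: "cls n (gen_word (basis_word n s)) = cls n f" "f \<in> carrier ?A" "?\<phi> f = 0"
        by (auto simp: basis_elt_def)
      have "valid n (i, i, 0, False)" using assms(1) by auto
      then have "?\<phi> (gen_word (basis_word n s)) = ?\<phi> f"
        using f Cons.prems(2) by (intro act_cls_eq) (auto simp: basis_word_closed simp del: valid.simps)
      with f(3) \<phi> [of s] show False by auto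
    qed
    ultimately have "basis_elt s \<notin> Pi.Span (scalars TYPE('k) n) (map basis_elt ss)"
      by blast
    moreover have "basis_elt s \<in> carrier (Pi_C TYPE('k) n)"
      using Cons.prems(2) by (intro basis_elt_closed) (simp del: valid.simps)
    moreover have "Pi.independent (scalars TYPE('k) n) (map basis_elt ss)"
      using Cons.prems by (intro Cons.IH) auto
    ultimately show ?case
      unfolding list.map by (intro Pi.li_Cons)
  qed simp
qed

lemma dimension_corner_part:
  assumes ij: "i \<in> {1..n}" "j \<in> {1..n}"
  shows "ring.dimension (Pi_C TYPE('k::field) n) (length (filter (P \<circ> degrees n) (states i j)))
     (scalars TYPE('k) n)
     (corner TYPE('k) n i j \<inter>
      cls n ` {f \<in> carrier (free_algebra (gens n)). \<forall>w\<in>Poly_Mapping.keys f. P (path_length w, x_degree w)})"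
proof -
  interpret Pi: ring "Pi_C TYPE('k) n" by (rule ring_Pi_C [OF n])
  have "Pi.independent (scalars TYPE('k) n) (map basis_elt (filter (P \<circ> degrees n) (states i j)))"
    using ij by (intro independent_basis) (auto simp: distinct_states set_states)
  from Pi.dimension_independent [OF this] show ?thesis
    unfolding corner_part [OF ij] by (simp del: Pi.Span.simps)
qed

end

section \<open>Hilbert series\<close>

lemma length_filter_upt: "length (filter Q [0..<k]) = (\<Sum>m<k. if Q m then 1 else 0)"
  by (induction k) auto

lemma t_var_power: "t_var ^ k = fps_const (fps_X ^ k)"
  by (induction k) (simp_all add: t_var_def)

lemma series_nth:
  "fps_nth (fps_nth (t_var ^ d * (\<Sum>m<k. t_var ^ (2 * m)) * (1 + s_var * t_var ^ e)) b) a =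
     (\<Sum>m<k. if d + 2 * m = a \<and> b = 0 then 1 else 0) +
     (\<Sum>m<k. if d + 2 * m + e = a \<and> b = 1 then 1 else 0)"
proof -
  have "t_var ^ d * (\<Sum>m<k. t_var ^ (2 * m)) * (1 + s_var * t_var ^ e) =
      (\<Sum>m<k. t_var ^ (d + 2 * m)) + s_var * (\<Sum>m<k. t_var ^ (d + 2 * m + e))"
    by (simp add: sum_distrib_left sum_distrib_right sum.distrib power_add algebra_simps)
  then show ?thesis
    by (simp add: t_var_power s_var_def fps_sum_nth if_distrib cong: if_cong)
      (auto intro!: sum.cong simp: fps_sum_nth)
qed

theorem corollary5p23:
  fixes n :: nat
  assumes "n \<ge> 4"
  shows "\<forall>i \<in> {1..n}. \<forall>j \<in> {1..n}.
     ring.dimension (Pi_C TYPE('k::field) n) (2 * min i j) (scalars TYPE('k) n)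
       (corner TYPE('k) n i j) \<and>
     hilbert_series TYPE('k) n i j =
       t_var ^ vdist i j * (\<Sum>m<min i j. t_var ^ (2 * m)) * (1 + s_var * t_var ^ (2 * vdist (max i j) n))"
proof (intro ballI conjI)
  fix i j assume ij: "i \<in> {1..n}" "j \<in> {1..n}"
  interpret linear_quiver n
    using assms by unfold_locales simp
  interpret Pi: ring "Pi_C TYPE('k) n"
    by (rule ring_Pi_C [OF n])
  have "corner TYPE('k) n i j \<subseteq> cls n ` carrier (free_algebra (gens n))"
    by (auto simp: corner_eq [OF ij])
  then show "Pi.dimension (2 * min i j) (scalars TYPE('k) n) (corner TYPE('k) n i j)"
    \<comment> \<open>With the constantly true predicate, all \<open>2 * min i j\<close> states are
      counted.\<close>
    using dimension_corner_part [OF ij, of "\<lambda>_. True", where 'k = 'k]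
    by (simp add: length_states o_def Int_absorb2)
  show "hilbert_series TYPE('k) n i j =
      t_var ^ vdist i j * (\<Sum>m<min i j. t_var ^ (2 * m)) * (1 + s_var * t_var ^ (2 * vdist (max i j) n))"
  proof (rule fps_ext, rule fps_ext)
    fix b a
    have "fps_nth (fps_nth (hilbert_series TYPE('k) n i j) b) a =
        Pi.dim (scalars TYPE('k) n) (corner TYPE('k) n i j \<inter> graded_part TYPE('k) n a b)"
      by (simp add: hilbert_series_def)
    also have "\<dots> = length (filter (\<lambda>s. degrees n s = (a, b)) (states i j))"
      using Pi.dimI [OF subfield_scalars dimension_corner_part [OF ij, of "\<lambda>d. d = (a, b)"]]
      unfolding graded_part_def over_def o_def prod.inject .
    also have "\<dots> = (\<Sum>m<min i j. if vdist i j + 2 * m = a \<and> b = 0 then 1 else 0) +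
        (\<Sum>m<min i j. if vdist i j + 2 * m + 2 * vdist (max i j) n = a \<and> b = 1 then 1 else 0)"
      \<comment> \<open>The states without and with the loop give the two sums, that is, the terms 1
        and s in the last factor of the series.\<close>
      unfolding states_def filter_append filter_map length_append length_map length_filter_upt o_def
      by (intro arg_cong2 [where f = plus] sum.cong) auto
    also have "\<dots> = fps_nth (fps_nth (t_var ^ vdist i j * (\<Sum>m<min i j. t_var ^ (2 * m)) *
        (1 + s_var * t_var ^ (2 * vdist (max i j) n))) b) a"
      by (rule series_nth [symmetric])
    finally show "fps_nth (fps_nth (hilbert_series TYPE('k) n i j) b) a = \<dots>" .
  qed
qed

end
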